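(* Let $\mathcal H$ be a Hilbert space and let $B$ be a closed operator in $\mathcal H$. The following statements are equivalent. (i) $B$ is similar to a self-adjoint operator $A$, that is, $B=TAT^{-1}$, with an intertwining operator $T$ satisfying $\|TE(\lambda)T^{-1}\|=1$ for every $\lambda\in\mathbb R$, where $\{E(\lambda)\}_{\lambda\in\mathbb R}$ is the spectral resolution of $A$ (so $A=\int_{\mathbb R}\lambda\,dE(\lambda)$). (ii) There exists a $*$-resolution of the identity $\{X(\lambda)\}_{\lambda\in\mathbb R}$ of $\mathcal H$, with $\gamma(X)=\sup_{\lambda\in\mathbb R}\|X(\lambda)\|=1$, such that $$B=\int_{\mathbb R}\lambda\,dX(\lambda).$$
   Context: Inner products $\langle\cdot|\cdot\rangle$ are linear in the first argument. Similarity: two densely defined operators $A$ and $B$, acting in Hilbert spaces, are similar if there is a bounded everywhere defined operator $T$ from the space of $A$ to the space of $B$, with bounded everywhere defined inverse $T^{-1}$, such that $T$ maps $D(A)$ onto $D(B)$ and $BT\xi=TA\xi$ for all $\xi\in D(A)$; i.e. $B=TAT^{-1}$ with $D(B)=TD(A)$. $T$ is called the intertwining operator. Resolution of the identity: a resolution of the identity of $\mathcal H$ on $\mathbb R$ is a family $\{X(\lambda)\}_{\lambda\in\mathbb R}$ of bounded operators on $\mathcal H$ (not necessarily self-adjoint) such that (1) $\gamma(X):=\sup_\lambda\|X(\lambda)\|<\infty$; (2) $X(\lambda)X(\mu)=X(\mu)X(\lambda)=X(\lambda)$ if $\lambda<\mu$; (3) $\lim_{\lambda\to-\infty}X(\lambda)\xi=0$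 and $\lim_{\lambda\to+\infty}X(\lambda)\xi=\xi$ for all $\xi\in\mathcal H$; (4) $\lim_{\epsilon\to0^+}X(\lambda+\epsilon)\xi=X(\lambda)\xi$ for all $\lambda\in\mathbb R$, $\xi\in\mathcal H$ (all limits in norm). It is a $*$-resolution of the identity if $\{X(\lambda)^*\}_{\lambda\in\mathbb R}$ is also a resolution of the identity. The operator $\int_{\mathbb R}\lambda\,dX(\lambda)$: for a $*$-resolution of the identity with $\gamma(X)=1$, the function $\lambda\mapsto\langle X(\lambda)\xi|\eta\rangle$ is of bounded variation and right continuous for all $\xi,\eta\in\mathcal H$, so it determines a complex Borel measure on $\mathbb R$ giving $]a,b]$ the value $\langle (X(b)-X(a))\xi|\eta\rangle$; integrals $\int_{\mathbb R}\lambda\,d\langle X(\lambda)\xi|\eta\rangle$ are taken with respect to it. Let $\mathcal D$ be the set of all $\xi\in\mathcal H$ such that $\int_{\mathbb R}\lambda\,d\langle X(\lambda)\xi|\eta\rangle$ exists for every $\eta\in\mathcal H$ and the conjugate linear functional $\eta\mapsto\int_{\mathbb R}\lambda\,d\langle X(\lambda)\xi|\eta\rangle$ is bounded on $\mathcal H$. Then $\int_{\mathbb R}\lambda\,dX(\lambda)$ denotes the operator $L$ with domain $\mathcal D$ determined by $\langle L\xi|\eta\rangle=\int_{\mathbb R}\lambda\,d\langle X(\lambda)\xi|\eta\rangle$ for $\xi\in\mathcal D$, $\eta\in\mathcal H$. Equality of operators in (ii) includes equality of domains.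
   Formalization: In (i), ‖TE(λ)T⁻¹‖=1 is required only for those λ with E(λ)≠0, and at least one E(λ)≠0 is required; for every λ the claim fails, e.g. for B=1 on ℂ, where E(λ)=0 for λ<1. *)

theory Defs
  imports "HOL-Analysis.Analysis"
begin

section \<open>Complex Hilbert spaces\<close>

text \<open>
  A complex Hilbert space carries the real Hilbert space structure given by the real part of its
  inner product; norm, topology and completeness are those of the underlying real space. The inner
  product is linear in the first argument.
\<close>

class complex_hilbert_space = real_inner + banach +
  fixes scaleC :: "complex \<Rightarrow> 'a \<Rightarrow> 'a"  (infixr "*\<^sub>C" 75)
    and cinner :: "'a \<Rightarrow> 'a \<Rightarrow> complex"
  assumes scaleC_add_right: "c *\<^sub>C (x + y) = c *\<^sub>C x + c *\<^sub>C y"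
    and scaleC_add_left: "(c + d) *\<^sub>C x = c *\<^sub>C x + d *\<^sub>C x"
    and scaleC_scaleC: "c *\<^sub>C (d *\<^sub>C x) = (c * d) *\<^sub>C x"
    and scaleR_eq_scaleC: "r *\<^sub>R x = complex_of_real r *\<^sub>C x"
    and cinner_commute: "cinner x y = cnj (cinner y x)"
    and cinner_add_left: "cinner (x + y) z = cinner x z + cinner y z"
    and cinner_scaleC_left: "cinner (c *\<^sub>C x) y = c * cinner x y"
    and inner_eq_Re_cinner: "inner x y = Re (cinner x y)"

definition bounded_clinear ::
    "('a::complex_hilbert_space \<Rightarrow> 'b::complex_hilbert_space) \<Rightarrow> bool" where
  "bounded_clinear T \<longleftrightarrow> bounded_linear T \<and> (\<forall>c x. T (c *\<^sub>C x) = c *\<^sub>C T x)"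

definition cadjoint ::
    "('a::complex_hilbert_space \<Rightarrow> 'b::complex_hilbert_space) \<Rightarrow> 'b \<Rightarrow> 'a" where
  "cadjoint T = (THE S. \<forall>x y. cinner (T x) y = cinner x (S y))"

section \<open>Unbounded operators\<close>

text \<open>
  An operator with domain \<^term>\<open>D\<close> is a partial map \<^term>\<open>A\<close> with \<^prop>\<open>dom A = D\<close>, so equality of
  partial maps is equality of operators including equality of domains.
\<close>

definition linear_operator ::
    "('a::complex_hilbert_space \<rightharpoonup> 'b::complex_hilbert_space) \<Rightarrow> bool" where
  "linear_operator A \<longleftrightarrow>
     A 0 = Some 0 \<and>
     (\<forall>x y u v. A x = Some u \<longrightarrow> A y = Some v \<longrightarrow> A (x + y) = Some (u + v)) \<and>
     (\<forall>c x u. A x = Some u \<longrightarrow> A (c *\<^sub>C x) = Some (c *\<^sub>C u))"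

definition closed_operator ::
    "('a::complex_hilbert_space \<rightharpoonup> 'b::complex_hilbert_space) \<Rightarrow> bool" where
  "closed_operator A \<longleftrightarrow> linear_operator A \<and> closed (Map.graph A)"

definition densely_defined ::
    "('a::complex_hilbert_space \<rightharpoonup> 'b::complex_hilbert_space) \<Rightarrow> bool" where
  "densely_defined A \<longleftrightarrow> closure (dom A) = UNIV"

definition adjoint_operator ::
    "('a::complex_hilbert_space \<rightharpoonup> 'b::complex_hilbert_space) \<Rightarrow> ('b \<rightharpoonup> 'a)" where
  "adjoint_operator A = (\<lambda>\<eta>.
     if \<exists>\<zeta>. \<forall>\<xi>\<in>dom A. cinner (the (A \<xi>)) \<eta> = cinner \<xi> \<zeta>
     then Some (THE \<zeta>. \<forall>\<xi>\<in>dom A. cinner (the (A \<xi>)) \<eta> = cinner \<xi> \<zeta>)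
     else None)"

definition self_adjoint_operator :: "('a::complex_hilbert_space \<rightharpoonup> 'a) \<Rightarrow> bool" where
  "self_adjoint_operator A \<longleftrightarrow>
     linear_operator A \<and> densely_defined A \<and> adjoint_operator A = A"

text \<open>\<open>similar_via T A B\<close>: \<open>A\<close> and \<open>B\<close> are similar, \<open>B = T A T\<^sup>-\<^sup>1\<close>, with intertwining operator \<open>T\<close>.\<close>

definition similar_via ::
    "('a::complex_hilbert_space \<Rightarrow> 'b::complex_hilbert_space) \<Rightarrow> ('a \<rightharpoonup> 'a) \<Rightarrow> ('b \<rightharpoonup> 'b) \<Rightarrow> bool"
  where
  "similar_via T A B \<longleftrightarrow>
     linear_operator A \<and> densely_defined A \<and> linear_operator B \<and> densely_defined B \<and>
     bounded_clinear T \<and> bij T \<and> bounded_clinear (inv T) \<and>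
     T ` dom A = dom B \<and> (\<forall>\<xi>\<in>dom A. the (B (T \<xi>)) = T (the (A \<xi>)))"

section \<open>Resolutions of the identity\<close>

definition resolution_of_identity :: "(real \<Rightarrow> 'a::complex_hilbert_space \<Rightarrow> 'a) \<Rightarrow> bool" where
  "resolution_of_identity X \<longleftrightarrow>
     (\<forall>l. bounded_clinear (X l)) \<and>
     bdd_above (range (\<lambda>l. onorm (X l))) \<and>
     (\<forall>l m. l < m \<longrightarrow> X l \<circ> X m = X m \<circ> X l \<and> X m \<circ> X l = X l) \<and>
     (\<forall>\<xi>. ((\<lambda>l. X l \<xi>) \<longlongrightarrow> 0) at_bot) \<and>
     (\<forall>\<xi>. ((\<lambda>l. X l \<xi>) \<longlongrightarrow> \<xi>) at_top) \<and>
     (\<forall>l \<xi>. ((\<lambda>\<epsilon>. X (l + \<epsilon>) \<xi>) \<longlongrightarrow> X l \<xi>) (at_right 0))"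

definition res_gamma :: "(real \<Rightarrow> 'a::complex_hilbert_space \<Rightarrow> 'a) \<Rightarrow> real" where
  "res_gamma X = (SUP l. onorm (X l))"

definition star_resolution_of_identity :: "(real \<Rightarrow> 'a::complex_hilbert_space \<Rightarrow> 'a) \<Rightarrow> bool"
  where
  "star_resolution_of_identity X \<longleftrightarrow>
     resolution_of_identity X \<and> resolution_of_identity (\<lambda>l. cadjoint (X l))"

section \<open>Complex Borel measures on the line and the operator \<open>\<integral> \<lambda> dX(\<lambda>)\<close>\<close>

definition complex_borel_measure :: "(real set \<Rightarrow> complex) \<Rightarrow> bool" where
  "complex_borel_measure \<mu> \<longleftrightarrow>
     (\<forall>S. range S \<subseteq> sets borel \<longrightarrow> disjoint_family S \<longrightarrow>
        (\<lambda>n::nat. \<mu> (S n)) sums \<mu> (\<Union>n. S n))"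

text \<open>
  \<open>polar_decomposition \<mu> M h\<close>: \<open>d\<mu> = h dM\<close> with \<open>|h| = 1\<close>. This forces \<open>M\<close> to be the total
  variation measure \<open>|\<mu>|\<close> and determines \<open>h\<close> up to \<open>|\<mu>|\<close>-null sets; a function is integrable with
  respect to \<open>\<mu>\<close> if it is integrable with respect to \<open>|\<mu>|\<close>, and then \<open>\<integral> f d\<mu> = \<integral> f h d|\<mu>|\<close>.
\<close>

definition polar_decomposition ::
    "(real set \<Rightarrow> complex) \<Rightarrow> real measure \<Rightarrow> (real \<Rightarrow> complex) \<Rightarrow> bool" where
  "polar_decomposition \<mu> M h \<longleftrightarrow>
     finite_measure M \<and> sets M = sets borel \<and> h \<in> borel_measurable borel \<and> (\<forall>x. norm (h x) = 1) \<and>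
     (\<forall>S\<in>sets borel. \<mu> S = (LINT x:S|M. h x))"

definition has_complex_integral ::
    "(real set \<Rightarrow> complex) \<Rightarrow> (real \<Rightarrow> complex) \<Rightarrow> complex \<Rightarrow> bool" where
  "has_complex_integral \<mu> f I \<longleftrightarrow>
     (\<exists>M h. polar_decomposition \<mu> M h \<and> integrable M f \<and> I = (LINT x|M. f x * h x))"

text \<open>
  Integration against \<open>dF\<close>, the complex Borel measure with value \<open>F b - F a\<close> on \<open>]a,b]\<close>; it is
  unique if it exists, and exists for right continuous \<open>F\<close> of bounded variation.
\<close>

definition has_stieltjes_integral ::
    "(real \<Rightarrow> complex) \<Rightarrow> (real \<Rightarrow> complex) \<Rightarrow> complex \<Rightarrow> bool" where
  "has_stieltjes_integral F f I \<longleftrightarrow>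
     (\<exists>\<mu>. complex_borel_measure \<mu> \<and> (\<forall>a b. a \<le> b \<longrightarrow> \<mu> {a<..b} = F b - F a) \<and>
          has_complex_integral \<mu> f I)"

definition stieltjes_integrable :: "(real \<Rightarrow> complex) \<Rightarrow> (real \<Rightarrow> complex) \<Rightarrow> bool" where
  "stieltjes_integrable F f \<longleftrightarrow> (\<exists>I. has_stieltjes_integral F f I)"

definition stieltjes_integral :: "(real \<Rightarrow> complex) \<Rightarrow> (real \<Rightarrow> complex) \<Rightarrow> complex" where
  "stieltjes_integral F f = (THE I. has_stieltjes_integral F f I)"

definition spectral_integral ::
    "(real \<Rightarrow> 'a::complex_hilbert_space \<Rightarrow> 'a) \<Rightarrow> ('a \<rightharpoonup> 'a)" where
  "spectral_integral X = (\<lambda>\<xi>.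
     if (\<forall>\<eta>. stieltjes_integrable (\<lambda>l. cinner (X l \<xi>) \<eta>) complex_of_real) \<and>
        (\<exists>C. \<forall>\<eta>. norm (stieltjes_integral (\<lambda>l. cinner (X l \<xi>) \<eta>) complex_of_real) \<le> C * norm \<eta>)
     then Some (THE \<zeta>. \<forall>\<eta>.
            cinner \<zeta> \<eta> = stieltjes_integral (\<lambda>l. cinner (X l \<xi>) \<eta>) complex_of_real)
     else None)"

text \<open>
  The spectral resolution of a self-adjoint operator \<open>A\<close>: the (unique) resolution of the identity
  by orthogonal projections with \<open>A = \<integral> \<lambda> dE(\<lambda>)\<close>.
\<close>

definition spectral_resolution ::
    "('a::complex_hilbert_space \<rightharpoonup> 'a) \<Rightarrow> (real \<Rightarrow> 'a \<Rightarrow> 'a) \<Rightarrow> bool" where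
  "spectral_resolution A E \<longleftrightarrow>
     resolution_of_identity E \<and>
     (\<forall>l. E l \<circ> E l = E l \<and> cadjoint (E l) = E l) \<and>
     A = spectral_integral E"

section \<open>Similarity to a self-adjoint operator\<close>

text \<open>
  Similarity of \<open>B\<close> to a self-adjoint operator \<open>A\<close> which may act in a Hilbert space \<open>'k\<close> other than
  that of \<open>B\<close>. As types cannot be quantified existentially, \<open>'k\<close> is a parameter: to derive the
  condition one takes \<open>'k = 'h\<close>; to deduce something from it, \<open>'k\<close> should be arbitrary.

  The requirement \<open>\<parallel>T E(\<lambda>) T\<^sup>-\<^sup>1\<parallel> = 1\<close> is imposed at all \<open>\<lambda>\<close> with \<open>E(\<lambda>) \<noteq> 0\<close>: if \<open>A\<close> is bounded below,
  then \<open>E(\<lambda>) = 0\<close> for \<open>\<lambda>\<close> below the spectrum, where the norm is necessarily \<open>0\<close>. At least one \<open>\<lambda>\<close>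
  with \<open>E(\<lambda>) \<noteq> 0\<close> is demanded, so that, as in the unrestricted requirement, the zero space is
  excluded.
\<close>

definition similar_to_self_adjoint_norm_one ::
    "'k::complex_hilbert_space itself \<Rightarrow> ('h::complex_hilbert_space \<rightharpoonup> 'h) \<Rightarrow> bool" where
  "similar_to_self_adjoint_norm_one _ B \<longleftrightarrow>
     (\<exists>(A :: 'k \<rightharpoonup> 'k) (T :: 'k \<Rightarrow> 'h) E.
        self_adjoint_operator A \<and> similar_via T A B \<and> spectral_resolution A E \<and>
        (\<exists>l. E l \<noteq> (\<lambda>_. 0)) \<and>
        (\<forall>l. E l \<noteq> (\<lambda>_. 0) \<longrightarrow> onorm (T \<circ> E l \<circ> inv T) = 1))"

end

theory Submission
  imports Defs
begin

text \<open>
  An idempotent of norm at most one on a Hilbert space is an orthogonal projection, so the resolutions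
  in (i) and (ii) both consist of orthogonal projections, and \<open>X(\<lambda>) = T E(\<lambda>) T\<^sup>-\<^sup>1\<close> passes from one to the
  other, with \<open>T = 1\<close> in the direction from (ii) to (i).

  For a resolution \<open>E\<close> by orthogonal projections let \<open>S x n\<close> be the \<open>n\<close>-th Riemann sum of
  \<open>\<integral> \<lambda> dE(\<lambda>) x\<close>. The weakly defined operator \<open>\<integral> \<lambda> dE(\<lambda>)\<close> is the strong limit of the \<open>S x n\<close>, with
  domain the set of all \<open>x\<close> for which the limit exists; this description is plainly compatible with
  conjugation by \<open>T\<close>. By the isometry between \<open>f \<mapsto> \<integral> f dE x\<close> and \<open>L\<^sup>2(d\<parallel>E x\<parallel>\<^sup>2)\<close>, convergence of
  \<open>S x\<close> is equivalent to its boundedness and to \<open>\<integral> \<lambda>\<^sup>2 d\<parallel>E(\<lambda>) x\<parallel>\<^sup>2 < \<infinity>\<close>. Both this identification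
  and self-adjointness reduce to the fact that a weak bound on \<open>S x\<close> implies that last finiteness.
\<close>

section \<open>Complex Hilbert spaces\<close>

lemma cinner_add_right: "cinner x (y + z) = cinner x y + cinner (x::'a::complex_hilbert_space) z"
  by (metis cinner_add_left cinner_commute complex_cnj_add)

lemma cinner_scaleC_right: "cinner x (c *\<^sub>C y) = cnj c * cinner (x::'a::complex_hilbert_space) y"
  by (metis cinner_commute cinner_scaleC_left complex_cnj_mult)

lemma Im_cinner: "Im (cinner x y) = inner x (\<i> *\<^sub>C (y::'a::complex_hilbert_space))"
  by (simp add: inner_eq_Re_cinner cinner_scaleC_right)

lemma cinner_eq_inner:
  "cinner (x::'a::complex_hilbert_space) y = Complex (inner x y) (inner x (\<i> *\<^sub>C y))"
  by (simp add: complex_eq_iff Im_cinner inner_eq_Re_cinner)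

lemma cinner_self: "cinner x x = complex_of_real ((norm (x::'a::complex_hilbert_space))\<^sup>2)"
proof -
  have "Im (cinner x x) = 0"
    using cinner_commute[of x x] by (simp add: complex_eq_iff)
  then show ?thesis
    by (simp add: complex_eq_iff power2_norm_eq_inner inner_eq_Re_cinner)
qed

lemma norm_scaleC: "norm (c *\<^sub>C x) = cmod c * norm (x::'a::complex_hilbert_space)"
proof -
  have "complex_of_real ((norm (c *\<^sub>C x))\<^sup>2) = (c * cnj c) * cinner x x"
    by (simp only: cinner_self[symmetric] cinner_scaleC_left cinner_scaleC_right ac_simps)
  also have "\<dots> = complex_of_real ((cmod c * norm x)\<^sup>2)"
    by (simp only: complex_norm_square[symmetric] cinner_self of_real_mult[symmetric] power_mult_distrib)
  finally have "(norm (c *\<^sub>C x))\<^sup>2 = (cmod c * norm x)\<^sup>2"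
    by (simp only: of_real_eq_iff)
  then show ?thesis by (simp add: power2_eq_iff_nonneg)
qed

text \<open>Multiplying \<open>x\<close> by the phase \<open>c\<close> turns
  \<open>cinner x y\<close> into its modulus, so the real Cauchy-Schwarz inequality applies.\<close>

lemma cmod_cinner_le: "cmod (cinner x y) \<le> norm x * norm (y::'a::complex_hilbert_space)"
proof -
  define c where "c = cnj (sgn (cinner x y))"
  have "c * cinner x y = cmod (cinner x y)"
  proof (cases "cinner x y = 0")
    case False
    have "c * cinner x y = cinner x y * cnj (cinner x y) / cmod (cinner x y)"
      by (simp add: c_def sgn_eq)
    also have "\<dots> = cmod (cinner x y)"
      using False by (simp add: complex_norm_square[symmetric] power2_eq_square)
    finally show ?thesis .
  qed simp
  then have "inner (c *\<^sub>C x) y = cmod (cinner x y)"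
    by (simp add: inner_eq_Re_cinner cinner_scaleC_left)
  then show ?thesis
    using norm_cauchy_schwarz[of "c *\<^sub>C x" y]
    by (cases "cinner x y = 0") (auto simp: norm_scaleC c_def norm_sgn)
qed

lemma bounded_bilinear_cinner:
  "bounded_bilinear (cinner :: 'a::complex_hilbert_space \<Rightarrow> _)"
  by (rule bounded_bilinear.intro)
    (auto simp: cinner_add_left cinner_add_right scaleR_eq_scaleC cinner_scaleC_left
      cinner_scaleC_right scaleR_conv_of_real cmod_cinner_le intro!: exI[of _ 1])

interpretation cinner: bounded_bilinear "cinner :: 'a::complex_hilbert_space \<Rightarrow> _"
  by (rule bounded_bilinear_cinner)

lemma cinner_ext:
  assumes "\<And>z. cinner x z = cinner (y::'a::complex_hilbert_space) z"
  shows "x = y"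
proof -
  have "cinner (x - y) (x - y) = 0"
    using assms[of "x - y"] by (simp add: cinner.diff_left)
  then show ?thesis by (simp add: cinner_self)
qed

lemma bounded_linear_scaleC: "bounded_linear (\<lambda>x::'a::complex_hilbert_space. c *\<^sub>C x)"
  by (rule bounded_linear_intro[where K="cmod c"])
    (auto simp: scaleC_add_right scaleR_eq_scaleC scaleC_scaleC norm_scaleC mult.commute)

lemma scaleC_zero [simp]: "c *\<^sub>C (0::'a::complex_hilbert_space) = 0"
  using bounded_linear_scaleC linear_0 bounded_linear.linear by blast

section \<open>Adjoint identities and contractive idempotents\<close>

lemma cadjoint_eqI:
  assumes "\<And>x y. cinner (T x) y = cinner x (S y)"
  shows "cadjoint T = S"
  unfolding cadjoint_def
proof (rule the_equality)
  show "\<forall>x y. cinner (T x) y = cinner x (S y)" using assms by blast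
  fix S' assume S': "\<forall>x y. cinner (T x) y = cinner x (S' y)"
  show "S' = S"
  proof
    fix y
    show "S' y = S y"
      by (rule cinner_ext) (metis S' assms cinner_commute)
  qed
qed

text \<open>Range and kernel of \<open>P\<close> are orthogonal, and decomposing \<open>x\<close>
  and \<open>y\<close> along them gives symmetry. This is how the norm condition of the theorem
  turns oblique projections into orthogonal ones.\<close>

lemma cinner_idempotent_contraction:
  fixes P :: "'a::complex_hilbert_space \<Rightarrow> 'a"
  assumes P: "bounded_clinear P" and idem: "\<And>x. P (P x) = P x" and le: "\<And>x. norm (P x) \<le> norm x"
  shows "cinner (P x) y = cinner x (P y)"
proof -
  interpret bounded_linear P using P by (simp add: bounded_clinear_def)
  \<comment> \<open>for \<open>u\<close> in the range and \<open>v\<close> in the kernel, \<open>u = P (u + t v)\<close> for every \<open>t\<close>\<close>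
  have orth_re: "inner u v = 0" if "P u = u" "P v = 0" for u v
  proof (rule ccontr)
    assume nz: "inner u v \<noteq> 0"
    then have vp: "inner v v > 0" by auto
    \<comment> \<open>This \<open>t\<close> minimises \<open>norm (u + t *\<^sub>R v)\<close>;
      unless \<open>inner u v = 0\<close> the minimum lies below \<open>norm u\<close>, against
      contractivity.\<close>
    define t where "t = - inner u v / inner v v"
    have "norm u \<le> norm (u + t *\<^sub>R v)"
      using le[of "u + t *\<^sub>R v"] that by (simp add: add scaleR)
    then have "inner u u \<le> inner (u + t *\<^sub>R v) (u + t *\<^sub>R v)"
      by (simp add: norm_le)
    also have "\<dots> = inner u u + 2 * t * inner u v + t * (t * inner v v)"
      by (simp add: inner_add_left inner_add_right inner_commute)
    also have "\<dots> = inner u u - (inner u v)\<^sup>2 / inner v v"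
      using vp by (simp add: t_def power2_eq_square)
    finally show False using vp nz by (simp add: divide_le_0_iff)
  qed
  \<comment> \<open>The kernel is a complex subspace, so \<open>\<i> *\<^sub>C v\<close> can replace
    \<open>v\<close>, which disposes of the imaginary part.\<close>
  have orth: "cinner u v = 0" if "P u = u" "P v = 0" for u v
    using that P by (simp add: cinner_eq_inner orth_re bounded_clinear_def Complex_eq_0)
  have "cinner (P x) (y - P y) = 0" "cinner (P y) (x - P x) = 0"
    by (auto intro!: orth simp: idem diff)
  then show ?thesis
    by (metis cinner.diff_right cinner_commute eq_iff_diff_eq_0)
qed

section \<open>Riemann sums and Stieltjes integrals\<close>

definition grid :: "nat \<Rightarrow> int \<Rightarrow> real" where
  "grid n k = of_int k / real (Suc n)"

text \<open>The cells \<open>]grid n k, grid n (k + 1)]\<close> with these \<open>k\<close> fill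
  \<open>]-(n + 1), n + 1]\<close> exactly: mesh and range are refined together, so one limit in
  \<open>n\<close> suffices.\<close>

definition cells :: "nat \<Rightarrow> int set" where
  "cells n = {- (int (Suc n))\<^sup>2 ..< (int (Suc n))\<^sup>2}"

definition riemann_sum :: "(real \<Rightarrow> 'a::real_vector) \<Rightarrow> nat \<Rightarrow> 'a" where
  "riemann_sum F n = (\<Sum>k\<in>cells n. grid n k *\<^sub>R (F (grid n (k + 1)) - F (grid n k)))"

text \<open>The step function belonging to \<open>riemann_sum\<close>, with the left endpoints as
  values and \<open>0\<close> outside the cells. Half-open cells match the intervals on which
  Stieltjes measures are prescribed.\<close>

definition staircase :: "nat \<Rightarrow> real \<Rightarrow> real" where
  "staircase n x = (\<Sum>k\<in>cells n. grid n k * indicator {grid n k<..grid n (k + 1)} x)"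

lemma finite_cells [simp]: "finite (cells n)"
  by (simp add: cells_def)

lemma grid_mono: "k \<le> l \<Longrightarrow> grid n k \<le> grid n l"
  by (simp add: grid_def divide_right_mono)

lemma cells_grid_bounds:
  assumes "k \<in> cells n"
  shows "- real (Suc n) \<le> grid n k" "grid n k \<le> real (Suc n)" "grid n (k + 1) \<le> real (Suc n)"
proof -
  have *: "- ((of_int (int (Suc n)))\<^sup>2 :: real) \<le> of_int k"
    "of_int (k + 1) \<le> ((of_int (int (Suc n)))\<^sup>2 :: real)"
    using assms unfolding cells_def of_int_power[symmetric] of_int_minus[symmetric] of_int_le_iff
    by auto
  show "- real (Suc n) \<le> grid n k" "grid n (k + 1) \<le> real (Suc n)"
    using * by (auto simp: grid_def power2_eq_square field_simps)
  then show "grid n k \<le> real (Suc n)"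
    using grid_mono[of k "k + 1" n] by simp
qed

text \<open>Cells are open on the left, so the index of the cell of \<open>x\<close> is a ceiling
  minus one and not a floor.\<close>

lemma staircase_eq:
  "staircase n x = (let k = \<lceil>x * real (Suc n)\<rceil> - 1 in if k \<in> cells n then grid n k else 0)"
proof -
  define k0 where "k0 = \<lceil>x * real (Suc n)\<rceil> - 1"
  have "x \<in> {grid n k<..grid n (k + 1)} \<longleftrightarrow> k = k0" for k
  proof -
    have "x \<in> {grid n k<..grid n (k + 1)} \<longleftrightarrow>
        of_int k < x * real (Suc n) \<and> x * real (Suc n) \<le> of_int k + 1"
      by (auto simp: grid_def divide_less_eq le_divide_eq)
    also have "\<dots> \<longleftrightarrow> k = k0"
      unfolding k0_def by linarith
    finally show ?thesis .
  qed
  then have "staircase n x = (\<Sum>k\<in>cells n. if k = k0 then grid n k else 0)"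
    unfolding staircase_def by (intro sum.cong) (auto simp: indicator_def)
  then show ?thesis by (simp add: k0_def Let_def sum.delta)
qed

lemma staircase_close:
  assumes "\<bar>x\<bar> < real (Suc n)"
  shows "\<bar>staircase n x - x\<bar> \<le> 1 / real (Suc n)"
proof -
  define y where "y = x * real (Suc n)"
  define k where "k = \<lceil>y\<rceil> - 1"
  define q where "q = (int (Suc n))\<^sup>2"
  have q: "of_int q = (real (Suc n))\<^sup>2" by (simp add: q_def)
  have "\<bar>y\<bar> < of_int q"
    using assms by (simp add: q y_def abs_mult power2_eq_square mult_strict_right_mono del: of_nat_Suc)
  then have "k \<in> cells n"
    unfolding cells_def k_def q_def[symmetric] atLeastLessThan_iff by linarith
  then have st: "staircase n x = grid n k"
    by (simp add: staircase_eq Let_def k_def y_def)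
  have "\<bar>of_int k - y\<bar> \<le> 1" unfolding k_def by linarith
  moreover have "grid n k - x = (of_int k - y) / real (Suc n)"
    by (simp add: grid_def y_def field_simps)
  ultimately show ?thesis unfolding st
    by (simp add: abs_divide divide_right_mono)
qed

text \<open>Uniform in \<open>n\<close>, with the default \<open>0\<close> beyond the cells
  included; this supplies the majorants for dominated convergence.\<close>

lemma staircase_bound: "\<bar>staircase n x\<bar> \<le> \<bar>x\<bar> + 1"
proof -
  define y where "y = x * real (Suc n)"
  define k where "k = \<lceil>y\<rceil> - 1"
  have "\<bar>of_int k - y\<bar> \<le> 1" unfolding k_def by linarith
  moreover have "grid n k - x = (of_int k - y) / real (Suc n)"
    by (simp add: grid_def y_def field_simps)
  ultimately have "\<bar>grid n k - x\<bar> \<le> 1 / real (Suc n)"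
    by (simp add: abs_divide divide_right_mono)
  also have "\<dots> \<le> 1" by simp
  finally show ?thesis
    by (auto simp: staircase_eq Let_def k_def y_def)
qed

lemma square_staircase_le: "(staircase n t)\<^sup>2 \<le> 2 * t\<^sup>2 + 2"
proof -
  have "(staircase n t)\<^sup>2 \<le> (\<bar>t\<bar> + 1)\<^sup>2"
    using staircase_bound[of n t] by (intro abs_le_square_iff[THEN iffD1]) simp
  also have "\<dots> \<le> 2 * t\<^sup>2 + 2"
    using zero_le_power2[of "\<bar>t\<bar> - 1"] by (simp add: power2_eq_square algebra_simps)
  finally show ?thesis .
qed

lemma staircase_tendsto: "(\<lambda>n. staircase n x) \<longlonglongrightarrow> x"
proof (rule Lim_transform_bound[of _ "\<lambda>n. 1 / real (Suc n)", THEN LIM_zero_cancel])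
  obtain N where N: "\<bar>x\<bar> < real N" using reals_Archimedean2 by blast
  show "\<forall>\<^sub>F n in sequentially. norm (staircase n x - x) \<le> norm (1 / real (Suc n))"
    using eventually_ge_at_top[of N]
  proof eventually_elim
    case (elim n)
    then show ?case using staircase_close[of x n] N by simp
  qed
  show "(\<lambda>n. 1 / real (Suc n)) \<longlonglongrightarrow> 0"
    using LIMSEQ_inverse_real_of_nat by (simp add: inverse_eq_divide)
qed

lemma borel_measurable_staircase [measurable]: "staircase n \<in> borel_measurable borel"
  unfolding staircase_def[abs_def] by measurable

lemma set_integrable_of_integrable:
  fixes f :: "'a \<Rightarrow> 'b::{banach, second_countable_topology}"
  shows "integrable M f \<Longrightarrow> S \<in> sets M \<Longrightarrow> set_integrable M S f"
  unfolding set_integrable_def by (rule integrable_mult_indicator)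

text \<open>Each cell contributes a set integral, which is an increment of \<open>F\<close>; only a
  primitive of \<open>f\<close> on half-open intervals has to be known.\<close>

lemma integral_staircase:
  fixes f :: "real \<Rightarrow> 'b::{banach, second_countable_topology}"
  assumes [measurable_cong]: "sets M = sets borel" and f: "integrable M f"
    and F: "\<And>a b. a \<le> b \<Longrightarrow> (LINT x:{a<..b}|M. f x) = F b - F a"
  shows "integrable M (\<lambda>x. staircase n x *\<^sub>R f x)"
    and "(LINT x|M. staircase n x *\<^sub>R f x) = riemann_sum F n"
proof -
  have eq: "staircase n x *\<^sub>R f x =
      (\<Sum>k\<in>cells n. grid n k *\<^sub>R (indicator {grid n k<..grid n (k + 1)} x *\<^sub>R f x))" for x
    unfolding staircase_def scaleR_left.sum by (simp only: scaleR_scaleR)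
  have int: "integrable M (\<lambda>x. indicator {grid n k<..grid n (k + 1)} x *\<^sub>R f x)" for k
    using f by (intro integrable_mult_indicator) auto
  show "integrable M (\<lambda>x. staircase n x *\<^sub>R f x)"
    unfolding eq by (intro Bochner_Integration.integrable_sum integrable_scaleR_right int)
  show "(LINT x|M. staircase n x *\<^sub>R f x) = riemann_sum F n"
    unfolding eq riemann_sum_def using int F[unfolded set_lebesgue_integral_def]
    by (subst Bochner_Integration.integral_sum) (auto simp: grid_mono simp del: scaleR_scaleR)
qed

text \<open>The Riemann sums depend on \<open>F\<close> alone, hence so does the Stieltjes integral.\<close>

lemma has_stieltjes_integral_riemann_sum:
  assumes "has_stieltjes_integral F complex_of_real I"
  shows "riemann_sum F \<longlonglongrightarrow> I"
proof -
  obtain \<mu> M h where \<mu>: "\<And>a b. a \<le> b \<Longrightarrow> \<mu> {a<..b} = F b - F a"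
    and pd: "polar_decomposition \<mu> M h" and int: "integrable M complex_of_real"
    and I: "I = (LINT x|M. complex_of_real x * h x)"
    using assms unfolding has_stieltjes_integral_def has_complex_integral_def by blast
  have fin: "finite_measure M" and sets[measurable_cong]: "sets M = sets borel"
    and h[measurable]: "h \<in> borel_measurable borel" and h1: "\<And>x. norm (h x) = 1"
    and \<mu>h: "\<And>S. S \<in> sets borel \<Longrightarrow> \<mu> S = (LINT x:S|M. h x)"
    using pd unfolding polar_decomposition_def by auto
  interpret finite_measure M by fact
  have inth: "integrable M h"
    by (rule integrable_const_bound[where B=1]) (auto simp: h1)
  have eq: "(LINT x|M. staircase n x *\<^sub>R h x) = riemann_sum F n" for n
    by (rule integral_staircase[OF sets inth]) (simp add: \<mu> flip: \<mu>h)
  have "(\<lambda>n. LINT x|M. staircase n x *\<^sub>R h x) \<longlonglongrightarrow> (LINT x|M. x *\<^sub>R h x)"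
  proof (rule integral_dominated_convergence[where w="\<lambda>x. \<bar>x\<bar> + 1"])
    show "integrable M (\<lambda>x. \<bar>x\<bar> + 1)"
      using integrable_norm[OF int] by simp
    show "AE x in M. (\<lambda>n. staircase n x *\<^sub>R h x) \<longlonglongrightarrow> x *\<^sub>R h x"
      by (intro AE_I2 tendsto_intros staircase_tendsto)
    show "AE x in M. norm (staircase n x *\<^sub>R h x) \<le> \<bar>x\<bar> + 1" for n
      by (simp add: h1 staircase_bound)
  qed measurable
  then show ?thesis unfolding eq by (simp add: I scaleR_conv_of_real)
qed

lemma stieltjes_integral_eq:
  "has_stieltjes_integral F complex_of_real I \<Longrightarrow> stieltjes_integral F complex_of_real = I"
  unfolding stieltjes_integral_def
  by (rule the_equality) (auto dest!: has_stieltjes_integral_riemann_sum intro: LIMSEQ_unique)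

section \<open>Countably additive set functions and finite measures on the line\<close>

lemma set_integral_sums:
  fixes f :: "'a \<Rightarrow> 'b::{banach, second_countable_topology}"
  assumes f: "integrable M f" and S: "range S \<subseteq> sets M" and disj: "disjoint_family S"
  shows "(\<lambda>n. LINT x:S n|M. f x) sums (LINT x:(\<Union>n. S n)|M. f x)"
proof -
  have [measurable]: "S n \<in> sets M" for n using S by auto
  have "(\<lambda>n. LINT x:(\<Union>i<n. S i)|M. f x) \<longlonglongrightarrow> (LINT x:(\<Union>n. \<Union>i<n. S i)|M. f x)"
    by (rule set_integral_cont_up)
      (auto intro!: set_integrable_of_integrable f incseq_SucI simp: less_Suc_eq)
  moreover have "(\<Union>n. \<Union>i<n. S i) = (\<Union>n. S n)" by auto
  moreover have "(LINT x:(\<Union>i<n. S i)|M. f x) = (\<Sum>i<n. LINT x:S i|M. f x)" for n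
    using disj by (intro set_integral_finite_Union)
      (auto simp: disjoint_family_on_def intro!: set_integrable_of_integrable f)
  ultimately show ?thesis by (simp add: sums_def)
qed

text \<open>A \<open>\<pi>\<close>-\<open>\<lambda>\<close> argument; countable additivity is stated with \<open>sums\<close> so that signed and complex
  measures are covered.\<close>

lemma countably_additive_eqI:
  fixes \<mu> \<nu> :: "real set \<Rightarrow> 'b::real_normed_vector"
  assumes \<mu>: "\<And>S. range S \<subseteq> sets borel \<Longrightarrow> disjoint_family S \<Longrightarrow> (\<lambda>n::nat. \<mu> (S n)) sums \<mu> (\<Union>n. S n)"
    and \<nu>: "\<And>S. range S \<subseteq> sets borel \<Longrightarrow> disjoint_family S \<Longrightarrow> (\<lambda>n::nat. \<nu> (S n)) sums \<nu> (\<Union>n. S n)"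
    and eq: "\<And>a b. a \<le> b \<Longrightarrow> \<mu> {a<..b} = \<nu> {a<..b}"
    and A: "A \<in> sets borel"
  shows "\<mu> A = \<nu> A"
proof -
  have empty: "\<mu> {} = \<nu> {}" using eq[of 0 0] by simp
  have Un: "\<mu> (\<Union>n. S n) = \<nu> (\<Union>n. S n)"
    if "range S \<subseteq> sets borel" "disjoint_family S" "\<And>n::nat. \<mu> (S n) = \<nu> (S n)" for S
    using \<mu>[OF that(1,2)] \<nu>[OF that(1,2)] that(3) by (simp add: sums_iff)
  have UNIV: "\<mu> UNIV = \<nu> UNIV"
  proof -
    \<comment> \<open>\<open>UNIV\<close> is not in the generator; it is the disjoint union of the
      intervals \<open>]k, k + 1]\<close>, enumerated by \<open>int_decode\<close>.\<close>
    define S :: "nat \<Rightarrow> real set"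
      where "S n = {of_int (int_decode n) <..of_int (int_decode n) + 1}" for n
    have mem: "x \<in> S n \<longleftrightarrow> int_decode n = \<lceil>x\<rceil> - 1" for x n
      unfolding S_def greaterThanAtMost_iff by linarith
    have "x \<in> S (int_encode (\<lceil>x\<rceil> - 1))" for x
      by (simp add: mem)
    then have "(\<Union>n. S n) = UNIV" by blast
    moreover have "disjoint_family S"
      unfolding disjoint_family_on_def
      by (auto simp: mem) (metis int_decode_inverse)
    moreover have "range S \<subseteq> sets borel" "\<And>n. \<mu> (S n) = \<nu> (S n)"
      by (auto simp: S_def eq)
    ultimately show ?thesis
      using Un[of S] by metis
  qed
  have Diff: "\<mu> (UNIV - B) = \<nu> (UNIV - B)" if B: "B \<in> sets borel" "\<mu> B = \<nu> B" for B
  proof -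
    \<comment> \<open>Additivity along \<open>UNIV - B\<close>, \<open>B\<close>, \<open>{}\<close>,
      \<open>{}\<close> and so on; the empty sets are carried along as a series, the same for
      \<open>\<mu>\<close> and \<open>\<nu>\<close>.\<close>
    have split: "\<rho> (UNIV - B) + \<rho> B + (suminf (\<lambda>n. \<rho> {})) = \<rho> UNIV"
      if \<rho>: "\<And>S. range S \<subseteq> sets borel \<Longrightarrow> disjoint_family S \<Longrightarrow> (\<lambda>n::nat. \<rho> (S n)) sums \<rho> (\<Union>n. S n)"
      for \<rho> :: "real set \<Rightarrow> 'b"
    proof -
      define S where "S n = (if n = 0 then UNIV - B else if n = 1 then B else {})" for n :: nat
      have "(\<lambda>n. \<rho> (S n)) sums \<rho> (\<Union>n. S n)"
        using B by (intro \<rho>) (auto simp: S_def disjoint_family_on_def)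
      moreover have "(\<Union>n. S n) = UNIV"
        by (auto simp: S_def intro: exI[of _ 0] exI[of _ 1])
      ultimately have *: "(\<lambda>n. \<rho> (S n)) sums \<rho> UNIV" by simp
      have "(\<lambda>n. \<rho> (S (n + 2))) sums (\<rho> UNIV - (\<Sum>i<2. \<rho> (S i)))"
        using * by (rule sums_split_initial_segment)
      then have "(\<lambda>n::nat. \<rho> {}) sums (\<rho> UNIV - (\<rho> (UNIV - B) + \<rho> B))"
        by (simp add: S_def numeral_2_eq_2)
      then show ?thesis by (simp add: sums_iff)
    qed
    show ?thesis
      using split[of \<mu>, OF \<mu>] split[of \<nu>, OF \<nu>] UNIV empty B(2)
      by (metis add_right_cancel)
  qed
  have sets: "sets (borel :: real measure) = sigma_sets UNIV (range (\<lambda>(a, b). {a<..b}))"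
    by (subst borel_sigma_sets_Ioc) simp
  have "Int_stable (range (\<lambda>(a, b). {a<..b::real}))"
    by (auto simp: Int_stable_def)
  moreover have "range (\<lambda>(a, b). {a<..b::real}) \<subseteq> Pow UNIV"
    by simp
  moreover have "A \<in> sigma_sets UNIV (range (\<lambda>(a, b). {a<..b}))"
    using A sets by simp
  ultimately show ?thesis
  proof (induction rule: sigma_sets_induct_disjoint)
    case (basic A)
    then obtain a b where A: "A = {a<..b}" by auto
    then show ?case using eq[of a b] empty by (cases "a \<le> b") auto
  qed (use empty Diff Un sets in auto)
qed

lemma UN_symmetric_Ioc: "(\<Union>n. {- real n<..real n}) = UNIV"
proof -
  have "\<exists>n. x \<in> {- real n<..real n}" for x
    using reals_Archimedean2[of "\<bar>x\<bar>"]
    by (metis abs_less_iff greaterThanAtMost_iff less_imp_le minus_less_iff)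
  then show ?thesis by auto
qed

lemma finite_measure_interval_measure:
  fixes \<Phi> :: "real \<Rightarrow> real"
  assumes mono: "mono \<Phi>" and cont: "\<And>a. continuous (at_right a) \<Phi>" and bd: "\<And>x. \<bar>\<Phi> x\<bar> \<le> C"
  shows "finite_measure (interval_measure \<Phi>)"
proof (rule finite_measureI)
  let ?M = "interval_measure \<Phi>"
  have "(\<lambda>n::nat. emeasure ?M {- real n<..real n}) \<longlonglongrightarrow> emeasure ?M (\<Union>n. {- real n<..real n})"
    by (rule Lim_emeasure_incseq) (auto simp: incseq_def)
  moreover have "(\<Union>n. {- real n<..real n}) = space ?M"
    by (simp add: UN_symmetric_Ioc)
  moreover have "emeasure ?M {- real n<..real n} \<le> ennreal (2 * C)" for n
    using bd[of n] bd[of "- n"]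
    by (subst emeasure_interval_measure_Ioc) (auto intro: monoD[OF mono] cont ennreal_leI)
  ultimately have "emeasure ?M (space ?M) \<le> ennreal (2 * C)"
    by (intro LIMSEQ_le_const2) auto
  then show "emeasure ?M (space ?M) \<noteq> \<infinity>"
    by (auto simp: top_unique)
qed

text \<open>The common reason why Riemann sums commute with inner products, with the cut-offs
  \<open>P m\<close> and with the intertwining operator.\<close>

lemma riemann_sum_linear:
  assumes "linear T"
  shows "T (riemann_sum F n) = riemann_sum (\<lambda>l. T (F l)) n"
proof -
  interpret linear T by fact
  show ?thesis by (simp add: riemann_sum_def sum scale diff)
qed

text \<open>The product rule covers only \<open>l < m\<close>; equal indices are reached by letting
  the larger one decrease to \<open>l\<close>, using right continuity.\<close>

lemma resolution_of_identity_idem: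
  assumes "resolution_of_identity X"
  shows "X l (X l x) = X l x"
proof -
  have bl: "bounded_linear (X l)" and lim: "((\<lambda>\<epsilon>. X (l + \<epsilon>) x) \<longlongrightarrow> X l x) (at_right 0)"
    using assms by (auto simp: resolution_of_identity_def bounded_clinear_def)
  have "X l (X (l + \<epsilon>) x) = X l x" if "\<epsilon> > 0" for \<epsilon>
    using assms that unfolding resolution_of_identity_def
    by (metis comp_apply less_add_same_cancel1)
  then have "\<forall>\<^sub>F \<epsilon> in at_right 0. X l (X (l + \<epsilon>) x) = X l x"
    by (auto simp: eventually_at_right_less eventually_at_filter)
  moreover have "((\<lambda>\<epsilon>. X l (X (l + \<epsilon>) x)) \<longlongrightarrow> X l (X l x)) (at_right 0)"
    by (rule bounded_linear.tendsto[OF bl lim])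
  ultimately have "((\<lambda>\<epsilon>::real. X l x) \<longlongrightarrow> X l (X l x)) (at_right 0)"
    by (rule Lim_transform_eventually[rotated])
  then show ?thesis
    by (simp add: tendsto_const_iff)
qed

section \<open>Resolutions of the identity by orthogonal projections\<close>

text \<open>The setting shared by the resolutions of (i) and (ii). Self-adjointness is put as an
  identity of inner products, the form in which it is applied.\<close>

locale projection_resolution =
  fixes E :: "real \<Rightarrow> 'a::complex_hilbert_space \<Rightarrow> 'a"
  assumes resolution: "resolution_of_identity E"
    and symmetric: "\<And>l x y. cinner (E l x) y = cinner x (E l y)"
begin

lemma bounded_linear_E: "bounded_linear (E l)"
  using resolution by (simp add: resolution_of_identity_def bounded_clinear_def)

sublocale E: bounded_linear "E l" for l
  by (rule bounded_linear_E)

lemma E_scaleC: "E l (c *\<^sub>C x) = c *\<^sub>C E l x"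
  using resolution by (simp add: resolution_of_identity_def bounded_clinear_def)

lemma inner_E: "inner (E l x) y = inner x (E l y)"
  by (simp add: inner_eq_Re_cinner symmetric)

lemma E_E: "E l (E m x) = E (min l m) x"
proof (cases l m rule: linorder_cases)
  case less
  then show ?thesis
    using resolution unfolding resolution_of_identity_def
    by (metis comp_apply less_imp_le min.absorb1)
next
  case equal
  then show ?thesis by (simp add: resolution_of_identity_idem[OF resolution])
next
  case greater
  then show ?thesis
    using resolution unfolding resolution_of_identity_def
    by (metis comp_apply less_imp_le min.absorb2)
qed

text \<open>This is \<open>(norm (E l x))\<^sup>2\<close>, the distribution function of the spectral
  measure of \<open>x\<close>.\<close>

definition \<Phi> :: "'a \<Rightarrow> real \<Rightarrow> real" where
  "\<Phi> x l = inner (E l x) x"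

lemma \<Phi>_diff: "a \<le> b \<Longrightarrow> \<Phi> x b - \<Phi> x a = (norm (E b x - E a x))\<^sup>2"
  by (simp add: \<Phi>_def power2_norm_eq_inner inner_diff_left inner_diff_right inner_E E_E inner_commute)

lemma mono_\<Phi>: "mono (\<Phi> x)"
proof
  fix a b :: real assume "a \<le> b"
  then show "\<Phi> x a \<le> \<Phi> x b" using \<Phi>_diff[of a b x] by (metis diff_ge_0_iff_ge zero_le_power2)
qed

lemma norm_E_le: "norm (E l x) \<le> norm x"
proof -
  have "(norm (E l x))\<^sup>2 = inner (E l x) x"
    by (simp add: power2_norm_eq_inner inner_E E_E inner_commute)
  also have "\<dots> \<le> norm (E l x) * norm x"
    by (rule norm_cauchy_schwarz)
  finally show ?thesis
    by (cases "norm (E l x) = 0") (auto simp: power2_eq_square)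
qed

lemma \<Phi>_bound: "\<bar>\<Phi> x l\<bar> \<le> (norm x)\<^sup>2"
proof -
  have "\<bar>\<Phi> x l\<bar> \<le> norm (E l x) * norm x"
    unfolding \<Phi>_def by (rule Cauchy_Schwarz_ineq2)
  also have "\<dots> \<le> norm x * norm x"
    by (intro mult_right_mono norm_E_le) auto
  finally show ?thesis by (simp add: power2_eq_square)
qed

lemma continuous_\<Phi>: "continuous (at_right a) (\<Phi> x)"
proof -
  have "((\<lambda>\<epsilon>. E (a + \<epsilon>) x) \<longlongrightarrow> E a x) (at_right 0)"
    using resolution by (simp add: resolution_of_identity_def)
  then have "((\<lambda>l. E l x) \<longlongrightarrow> E a x) (at_right a)"
    by (subst filterlim_at_right_to_0) (simp add: add.commute)
  then show ?thesis
    unfolding continuous_within \<Phi>_def by (intro tendsto_intros)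
qed

lemma E_tendsto_top: "((\<lambda>l. E l x) \<longlongrightarrow> x) at_top"
  and E_tendsto_bot: "((\<lambda>l. E l x) \<longlongrightarrow> 0) at_bot"
  using resolution by (auto simp: resolution_of_identity_def)

abbreviation M :: "'a \<Rightarrow> real measure" where
  "M x \<equiv> interval_measure (\<Phi> x)"

lemma finite_measure_M: "finite_measure (M x)"
  by (rule finite_measure_interval_measure[OF mono_\<Phi> continuous_\<Phi> \<Phi>_bound])

lemma measure_M_Ioc: "a \<le> b \<Longrightarrow> measure (M x) {a<..b} = \<Phi> x b - \<Phi> x a"
  by (rule measure_interval_measure_Ioc) (auto intro: monoD[OF mono_\<Phi>] continuous_\<Phi>)

section \<open>Riemann sums and their isometry with staircases\<close>

definition S :: "'a \<Rightarrow> nat \<Rightarrow> 'a" where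
  "S x = riemann_sum (\<lambda>l. E l x)"

text \<open>The spectral projections of two intervals multiply to that of their intersection; the
  \<open>else\<close> branch is the empty intersection.\<close>

lemma inner_increments:
  assumes "a \<le> b" "c \<le> d"
  shows "inner (E b x - E a x) (E d y - E c y) =
    (if max a c \<le> min b d then inner (E (min b d) x) y - inner (E (max a c) x) y else 0)"
  using assms
  by (auto simp: inner_diff_left inner_diff_right inner_E E_E min_def max_def)

text \<open>\<open>integral_staircase\<close> is used twice: on a fixed \<open>]a, b]\<close> it
  shows that \<open>inner (E b x) (S y k)\<close> is a primitive of
  \<open>staircase k t * f t\<close>, and for this primitive it then yields the product.\<close>

lemma integral_staircase_product:
  fixes f :: "real \<Rightarrow> real"
  assumes sets: "sets N = sets borel" and f: "integrable N f"
    and F: "\<And>a b. a \<le> b \<Longrightarrow> (LINT t:{a<..b}|N. f t) = inner (E b x) y - inner (E a x) y"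
  shows "integrable N (\<lambda>t. staircase n t * (staircase k t * f t))"
    and "(LINT t|N. staircase n t * (staircase k t * f t)) = inner (S x n) (S y k)"
proof -
  note [measurable_cong] = sets
  have int1: "integrable N (\<lambda>t. staircase k t * f t)"
    using integral_staircase(1)[OF sets f F] by simp
  have "(LINT t:{a<..b}|N. staircase k t * f t) = inner (E b x) (S y k) - inner (E a x) (S y k)"
    if ab: "a \<le> b" for a b
  proof -
    let ?u = "E b x - E a x"
    have "(LINT t:{c<..d}|N. indicator {a<..b} t * f t) = inner ?u (E d y) - inner ?u (E c y)"
      if cd: "c \<le> d" for c d
    proof -
      have "(LINT t:{c<..d}|N. indicator {a<..b} t * f t) = (LINT t:{max a c<..min b d}|N. f t)"
        unfolding set_lebesgue_integral_def
        by (intro Bochner_Integration.integral_cong) (auto simp: indicator_def)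
      also have "\<dots> = inner ?u (E d y - E c y)"
      proof (cases "max a c \<le> min b d")
        case False
        then have "{max a c<..min b d} = {}"
          by (intro greaterThanAtMost_empty) linarith
        then have "(LINT t:{max a c<..min b d}|N. f t) = 0"
          by (simp only: set_lebesgue_integral_def indicator_simps empty_iff scaleR_zero_left
              not_False_eq_True Bochner_Integration.integral_zero)
        then show ?thesis unfolding inner_increments[OF ab cd] if_not_P[OF False] .
      next
        case True
        then show ?thesis unfolding inner_increments[OF ab cd] using F[OF True] by simp
      qed
      finally show ?thesis by (simp add: inner_diff_right)
    qed
    then have "(LINT t|N. staircase k t *\<^sub>R (indicator {a<..b} t * f t)) =
        riemann_sum (\<lambda>l. inner ?u (E l y)) k"
      using integrable_mult_indicator[OF _ f, of "{a<..b}"]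
      by (intro integral_staircase(2)[OF sets]) auto
    also have "\<dots> = inner ?u (S y k)"
      unfolding S_def
      by (rule riemann_sum_linear[symmetric])
        (rule bounded_linear.linear[OF bounded_linear_inner_right])
    finally show ?thesis
      by (simp add: set_lebesgue_integral_def inner_diff_left mult_ac)
  qed
  note * = integral_staircase[OF sets int1 this]
  show "integrable N (\<lambda>t. staircase n t * (staircase k t * f t))"
    using *(1) by simp
  have "(LINT t|N. staircase n t * (staircase k t * f t)) = riemann_sum (\<lambda>l. inner (E l x) (S y k)) n"
    using *(2) by simp
  also have "\<dots> = inner (S x n) (S y k)"
    unfolding S_def
    by (rule riemann_sum_linear[symmetric])
      (rule bounded_linear.linear[OF bounded_linear_inner_left])
  finally show "(LINT t|N. staircase n t * (staircase k t * f t)) = inner (S x n) (S y k)" .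
qed

text \<open>For \<open>M x\<close> the constant \<open>1\<close> has primitive
  \<open>\<Phi> x\<close>, so inner products of Riemann sums are those of staircases in
  \<open>L\<^sup>2(M x)\<close>.\<close>

lemma integral_staircase_product_M:
  shows "integrable (M x) (\<lambda>t. staircase n t * staircase k t)"
    and "(LINT t|M x. staircase n t * staircase k t) = inner (S x n) (S x k)"
proof -
  interpret finite_measure "M x" by (rule finite_measure_M)
  have *: "(LINT t:{a<..b}|M x. 1) = inner (E b x) x - inner (E a x) x" if "a \<le> b" for a b
    using that measure_M_Ioc[of a b x] by (simp add: set_lebesgue_integral_def \<Phi>_def)
  show "integrable (M x) (\<lambda>t. staircase n t * staircase k t)"
    "(LINT t|M x. staircase n t * staircase k t) = inner (S x n) (S x k)"
    using integral_staircase_product[of "M x" "\<lambda>_. 1", OF _ _ *] by auto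
qed

lemma norm_S_diff:
  "integrable (M x) (\<lambda>t. (staircase n t - staircase k t)\<^sup>2)"
  "(norm (S x n - S x k))\<^sup>2 = (LINT t|M x. (staircase n t - staircase k t)\<^sup>2)"
proof -
  note int = integral_staircase_product_M(1)[of x]
  have eq: "(staircase n t - staircase k t)\<^sup>2 = staircase n t * staircase n t
      - staircase n t * staircase k t - (staircase k t * staircase n t - staircase k t * staircase k t)" for t
    by (simp add: power2_eq_square algebra_simps)
  show "integrable (M x) (\<lambda>t. (staircase n t - staircase k t)\<^sup>2)"
    unfolding eq by (intro Bochner_Integration.integrable_diff int)
  have "(LINT t|M x. (staircase n t - staircase k t)\<^sup>2) =
      inner (S x n) (S x n) - inner (S x n) (S x k) - (inner (S x k) (S x n) - inner (S x k) (S x k))"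
    unfolding eq by (simp only: Bochner_Integration.integral_diff Bochner_Integration.integrable_diff
        int integral_staircase_product_M(2))
  then show "(norm (S x n - S x k))\<^sup>2 = (LINT t|M x. (staircase n t - staircase k t)\<^sup>2)"
    by (simp add: power2_norm_eq_inner inner_diff_left inner_diff_right inner_commute)
qed

text \<open>The domain of \<open>\<integral> \<lambda> dE(\<lambda>)\<close> in two equivalent forms, tied together by the isometry
  \<open>\<parallel>S x n - S x k\<parallel> = \<parallel>staircase n - staircase k\<parallel>\<close> in \<open>L\<^sup>2(M x)\<close>.\<close>

lemma S_convergent_if_square_integrable:
  assumes int: "integrable (M x) (\<lambda>t. t\<^sup>2)"
  shows "convergent (S x)"
proof -
  interpret finite_measure "M x" by (rule finite_measure_M)
  define w where "w t = (2 * \<bar>t\<bar> + 1)\<^sup>2" for t :: real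
  have w: "integrable (M x) w"
  proof (rule Bochner_Integration.integrable_bound[where f="\<lambda>t. 8 * t\<^sup>2 + 2"])
    show "integrable (M x) (\<lambda>t. 8 * t\<^sup>2 + 2)" using int by simp
    show "AE t in M x. norm (w t) \<le> norm (8 * t\<^sup>2 + 2)"
    proof (rule AE_I2)
      fix t :: real
      have "(2 * \<bar>t\<bar> - 1)\<^sup>2 \<ge> 0" by simp
      then show "norm (w t) \<le> norm (8 * t\<^sup>2 + 2)"
        by (simp add: w_def power2_eq_square algebra_simps)
    qed
  qed (simp add: w_def[abs_def])
  have w_bound: "(staircase n t - t)\<^sup>2 \<le> w t" for n t
  proof -
    have "\<bar>staircase n t - t\<bar> \<le> 2 * \<bar>t\<bar> + 1" using staircase_bound[of n t] by linarith
    then have "\<bar>staircase n t - t\<bar>\<^sup>2 \<le> w t" unfolding w_def by (rule power_mono) simp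
    then show ?thesis by simp
  qed
  \<comment> \<open>The staircases tend to the identity function in \<open>L\<^sup>2(M x)\<close>;
    by the isometry \<open>S x\<close> is then a Cauchy sequence.\<close>
  have "(\<lambda>n. LINT t|M x. (staircase n t - t)\<^sup>2) \<longlonglongrightarrow> (LINT t|M x. 0)"
  proof (rule integral_dominated_convergence[where w=w])
    show "AE t in M x. (\<lambda>n. (staircase n t - t)\<^sup>2) \<longlonglongrightarrow> 0"
      by (rule AE_I2) (rule tendsto_eq_intros staircase_tendsto refl | simp)+
    show "AE t in M x. norm ((staircase n t - t)\<^sup>2) \<le> w t" for n
      using w_bound by simp
  qed (use w in auto)
  then have lim: "(\<lambda>n. LINT t|M x. (staircase n t - t)\<^sup>2) \<longlonglongrightarrow> 0" by simp
  have int2: "integrable (M x) (\<lambda>t. (staircase n t - t)\<^sup>2)" for n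
  proof (rule Bochner_Integration.integrable_bound[OF w])
    show "AE t in M x. norm ((staircase n t - t)\<^sup>2) \<le> norm (w t)"
      using w_bound by (simp add: w_def)
  qed measurable
  have est: "(norm (S x n - S x k))\<^sup>2 \<le>
      2 * (LINT t|M x. (staircase n t - t)\<^sup>2) + 2 * (LINT t|M x. (staircase k t - t)\<^sup>2)" for n k
  proof -
    have "(norm (S x n - S x k))\<^sup>2 = (LINT t|M x. (staircase n t - staircase k t)\<^sup>2)"
      by (rule norm_S_diff)
    also have "\<dots> \<le> (LINT t|M x. 2 * (staircase n t - t)\<^sup>2 + 2 * (staircase k t - t)\<^sup>2)"
    proof (rule integral_mono)
      fix t
      have "0 \<le> ((staircase n t - t) + (staircase k t - t))\<^sup>2" by simp
      then show "(staircase n t - staircase k t)\<^sup>2 \<le> 2 * (staircase n t - t)\<^sup>2 + 2 * (staircase k t - t)\<^sup>2"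
        by (simp add: power2_eq_square algebra_simps)
    qed (use int2 norm_S_diff in auto)
    finally show ?thesis using int2 by simp
  qed
  have "Cauchy (S x)"
  proof (rule metric_CauchyI)
    fix e :: real assume "e > 0"
    then have "e\<^sup>2 / 4 > 0" by simp
    then obtain N where N: "\<And>n. n \<ge> N \<Longrightarrow> \<bar>LINT t|M x. (staircase n t - t)\<^sup>2\<bar> < e\<^sup>2 / 4"
      using LIMSEQ_D[OF lim] by (metis diff_zero real_norm_def)
    have "dist (S x n) (S x k) < e" if "n \<ge> N" "k \<ge> N" for n k
    proof -
      have "(norm (S x n - S x k))\<^sup>2 < e\<^sup>2"
        using est[of n k] N[OF that(1)] N[OF that(2)] by linarith
      then show ?thesis
        using \<open>e > 0\<close> by (simp add: dist_norm power2_less_imp_less)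
    qed
    then show "\<exists>N. \<forall>n\<ge>N. \<forall>k\<ge>N. dist (S x n) (S x k) < e" by blast
  qed
  then show ?thesis by (rule Cauchy_convergent)
qed

text \<open>Fatou's lemma: the squared staircases tend pointwise to \<open>t\<^sup>2\<close>, and
  their integrals are \<open>(norm (S x n))\<^sup>2\<close>.\<close>

lemma square_integrable_if_S_bounded:
  assumes bd: "\<And>n. norm (S x n) \<le> C"
  shows "integrable (M x) (\<lambda>t. t\<^sup>2)"
proof (rule integrableI_bounded)
  have "(\<integral>\<^sup>+t. ennreal ((staircase n t)\<^sup>2) \<partial>M x) \<le> ennreal (C\<^sup>2)" for n
  proof -
    have "(\<integral>\<^sup>+t. ennreal ((staircase n t)\<^sup>2) \<partial>M x) = ennreal (LINT t|M x. (staircase n t)\<^sup>2)"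
      using integral_staircase_product_M(1)[of x n n]
      by (intro nn_integral_eq_integral) (auto simp: power2_eq_square)
    also have "(LINT t|M x. (staircase n t)\<^sup>2) = (norm (S x n))\<^sup>2"
      using integral_staircase_product_M(2)[of x n n] by (simp add: power2_eq_square power2_norm_eq_inner[symmetric])
    also have "ennreal \<dots> \<le> ennreal (C\<^sup>2)"
      by (intro ennreal_leI power_mono bd) simp
    finally show ?thesis .
  qed
  then have le: "liminf (\<lambda>n. \<integral>\<^sup>+t. ennreal ((staircase n t)\<^sup>2) \<partial>M x) \<le> ennreal (C\<^sup>2)"
    by (intro order.trans[OF Liminf_le_Limsup Limsup_bounded]) auto
  have "(\<integral>\<^sup>+t. ennreal (t\<^sup>2) \<partial>M x) = (\<integral>\<^sup>+t. liminf (\<lambda>n. ennreal ((staircase n t)\<^sup>2)) \<partial>M x)"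
  proof (rule nn_integral_cong)
    fix t
    have "(\<lambda>n. ennreal ((staircase n t)\<^sup>2)) \<longlonglongrightarrow> ennreal (t\<^sup>2)"
      by (intro tendsto_ennrealI tendsto_intros staircase_tendsto)
    then show "ennreal (t\<^sup>2) = liminf (\<lambda>n. ennreal ((staircase n t)\<^sup>2))"
      by (rule lim_imp_Liminf[OF sequentially_bot, symmetric])
  qed
  also have "\<dots> \<le> liminf (\<lambda>n. \<integral>\<^sup>+t. ennreal ((staircase n t)\<^sup>2) \<partial>M x)"
    by (rule nn_integral_liminf) measurable
  also note le
  finally show "(\<integral>\<^sup>+t. ennreal (norm (t\<^sup>2)) \<partial>M x) < \<infinity>"
    by (simp add: le_less_trans ennreal_less_top)
qed simp

end

section \<open>Densities and existence of the Stieltjes integrals\<close>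

text \<open>As \<open>\<Psi> - \<Phi>\<close> increases, adding its measure to that of
  \<open>\<Phi>\<close> gives that of \<open>\<Psi>\<close>, first on intervals and then on Borel
  sets. This domination gives absolute continuity, and Radon-Nikodym gives \<open>D\<close>.\<close>

lemma interval_measure_density:
  fixes \<Phi> \<Psi> :: "real \<Rightarrow> real"
  assumes mono: "mono \<Phi>" "mono \<Psi>" "mono (\<lambda>x. \<Psi> x - \<Phi> x)"
    and cont: "\<And>a. continuous (at_right a) \<Phi>" "\<And>a. continuous (at_right a) \<Psi>"
    and bd: "\<And>x. \<bar>\<Phi> x\<bar> \<le> C" "\<And>x. \<bar>\<Psi> x\<bar> \<le> C"
  obtains D :: "real \<Rightarrow> real" where "D \<in> borel_measurable borel" "\<And>x. 0 \<le> D x"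
    "interval_measure \<Phi> = density (interval_measure \<Psi>) D"
proof -
  let ?N = "interval_measure \<Phi>" and ?M = "interval_measure \<Psi>"
    and ?K = "interval_measure (\<lambda>x. \<Psi> x - \<Phi> x)"
  have contd: "continuous (at_right a) (\<lambda>x. \<Psi> x - \<Phi> x)" for a
    by (intro continuous_intros cont)
  have bdd: "\<bar>\<Psi> x - \<Phi> x\<bar> \<le> 2 * C" for x
    using bd[of x] by linarith
  interpret N: finite_measure ?N by (rule finite_measure_interval_measure[OF mono(1) cont(1) bd(1)])
  interpret M: finite_measure ?M by (rule finite_measure_interval_measure[OF mono(2) cont(2) bd(2)])
  interpret K: finite_measure ?K by (rule finite_measure_interval_measure[OF mono(3) contd bdd])
  have sum: "measure ?N A + measure ?K A = measure ?M A" if "A \<in> sets borel" for A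
  proof (rule countably_additive_eqI[OF _ _ _ that])
    fix a b :: real assume ab: "a \<le> b"
    show "measure ?N {a<..b} + measure ?K {a<..b} = measure ?M {a<..b}"
      using measure_interval_measure_Ioc[OF ab monoD[OF mono(1)] cont(1)]
        measure_interval_measure_Ioc[OF ab monoD[OF mono(2)] cont(2)]
        measure_interval_measure_Ioc[OF ab monoD[OF mono(3)] contd] by simp
  next
    fix B :: "nat \<Rightarrow> real set"
    assume B: "range B \<subseteq> sets borel" "disjoint_family B"
    show "(\<lambda>n. measure ?N (B n) + measure ?K (B n)) sums (measure ?N (\<Union>n. B n) + measure ?K (\<Union>n. B n))"
      using B by (intro sums_add N.finite_measure_UNION K.finite_measure_UNION) simp_all
    show "(\<lambda>n. measure ?M (B n)) sums measure ?M (\<Union>n. B n)"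
      using B by (intro M.finite_measure_UNION) simp_all
  qed
  have ac: "absolutely_continuous ?M ?N"
    unfolding absolutely_continuous_def
  proof
    fix A assume A: "A \<in> null_sets ?M"
    then have "measure ?N A + measure ?K A = 0"
      using sum[of A] by (auto simp: measure_eq_0_null_sets)
    then have "measure ?N A = 0"
      using measure_nonneg[of ?N A] measure_nonneg[of ?K A] by linarith
    then show "A \<in> null_sets ?N"
      using A by (intro null_setsI) (auto simp: N.emeasure_eq_measure)
  qed
  obtain D where D: "D \<in> borel_measurable ?M" "AE x in ?M. RN_deriv ?M ?N x = ennreal (D x)"
    "\<And>x. 0 \<le> D x"
    using M.real_RN_deriv[OF N.finite_measure_axioms ac] by auto
  have "?N = density ?M (RN_deriv ?M ?N)"
    using ac by (simp add: M.density_RN_deriv)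
  also have "\<dots> = density ?M D"
    by (rule density_cong) (use D in auto)
  finally have "?N = density ?M D" .
  from that[OF _ D(3) this] D(1) show thesis by simp
qed

lemma density_integrals:
  fixes D :: "real \<Rightarrow> real"
  assumes N: "finite_measure N" "N = density M D"
    and D: "D \<in> borel_measurable M" "\<And>x. 0 \<le> D x"
  shows "integrable M D"
    and "A \<in> sets M \<Longrightarrow> (LINT x:A|M. D x) = measure N A"
proof -
  interpret finite_measure N by fact
  have "integrable N (\<lambda>_. 1::real)" by simp
  then show "integrable M D"
    using D by (simp add: N(2) integrable_density)
  show "(LINT x:A|M. D x) = measure N A" if "A \<in> sets M"
  proof -
    have "measure N A = integral\<^sup>L N (indicator A)"
      using that sets.sets_into_space[OF that] by (simp add: N(2) Int_absorb2)
    also have "\<dots> = (LINT x|M. D x *\<^sub>R indicator A x)"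
      unfolding N(2) using that D by (intro integral_density) auto
    finally show ?thesis
      by (simp add: set_lebesgue_integral_def mult.commute)
  qed
qed

text \<open>Testing on the set where \<open>f\<close> is negative forces the integral of the
  negative part to vanish.\<close>

lemma AE_nonneg_if_set_integrals_nonneg:
  fixes f :: "'a \<Rightarrow> real"
  assumes f: "integrable M f" and nn: "\<And>A. A \<in> sets M \<Longrightarrow> 0 \<le> (LINT x:A|M. f x)"
  shows "AE x in M. 0 \<le> f x"
proof -
  have [measurable]: "f \<in> borel_measurable M" using f by simp
  let ?A = "{x\<in>space M. f x < 0}"
  have int: "integrable M (\<lambda>x. - (indicator ?A x *\<^sub>R f x))"
    using f by (intro Bochner_Integration.integrable_minus integrable_mult_indicator) auto
  have pos: "AE x in M. 0 \<le> - (indicator ?A x *\<^sub>R f x)"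
    by (auto simp: indicator_def)
  have "integral\<^sup>L M (\<lambda>x. - (indicator ?A x *\<^sub>R f x)) \<le> 0"
    using nn[of ?A] by (simp add: set_lebesgue_integral_def)
  moreover have "integral\<^sup>L M (\<lambda>x. - (indicator ?A x *\<^sub>R f x)) \<ge> 0"
    using pos by (rule integral_nonneg_AE)
  ultimately have "AE x in M. - (indicator ?A x *\<^sub>R f x) = 0"
    using integral_nonneg_eq_0_iff_AE[OF int pos] by linarith
  then show ?thesis
    by (rule AE_mp) (auto simp: indicator_def intro!: AE_I2)
qed

text \<open>Only countably many null sets can be united, so \<open>c\<close> first runs through a
  countable dense set; by continuity a negative value would persist on an open set meeting
  it.\<close>

lemma AE_complex_dense:
  fixes F :: "complex \<Rightarrow> 'a \<Rightarrow> real"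
  assumes ae: "\<And>c. AE t in M. 0 \<le> F c t" and cont: "\<And>t. continuous_on UNIV (\<lambda>c. F c t)"
  shows "AE t in M. \<forall>c. 0 \<le> F c t"
proof -
  obtain D :: "complex set" where D: "countable D" "\<And>X. open X \<Longrightarrow> X \<noteq> {} \<Longrightarrow> \<exists>d\<in>D. d \<in> X"
    using countable_dense_setE by blast
  have "AE t in M. \<forall>c\<in>D. 0 \<le> F c t"
    using D(1) ae by (simp add: AE_ball_countable)
  then show ?thesis
  proof (rule AE_mp, intro AE_I2 impI allI)
    fix t c assume *: "\<forall>c\<in>D. 0 \<le> F c t"
    have "open ((\<lambda>c. F c t) -` {..<0})"
      using cont[of t] by (intro open_vimage) auto
    then show "0 \<le> F c t"
      using D(2)[of "(\<lambda>c. F c t) -` {..<0}"] *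
      by (metis empty_iff lessThan_iff linorder_not_le vimage_eq)
  qed
qed

context projection_resolution
begin

lemma polarization:
  "inner (E l x) y = (\<Phi> (x + y) l - \<Phi> x l - \<Phi> y l) / 2"
  by (simp add: \<Phi>_def E.add inner_add_left inner_add_right) (metis inner_E inner_commute)

lemma \<Phi>_parallelogram: "\<Phi> (x + y) l + \<Phi> (x - y) l = 2 * (\<Phi> x l + \<Phi> y l)"
  by (simp add: \<Phi>_def E.add E.diff inner_add_left inner_add_right inner_diff_left inner_diff_right)

lemma \<Phi>_ii: "\<Phi> (\<i> *\<^sub>C x) l = \<Phi> x l"
  by (simp add: \<Phi>_def E_scaleC inner_eq_Re_cinner cinner_scaleC_left cinner_scaleC_right)

text \<open>Shows how the density of \<open>M (c *\<^sub>C x - y)\<close> depends on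
  \<open>c\<close>: it is a quadratic expression in densities that do not involve
  \<open>c\<close>.\<close>

lemma \<Phi>_scaleC_diff:
  "\<Phi> (c *\<^sub>C x - y) l = (cmod c)\<^sup>2 * \<Phi> x l + \<Phi> y l - 2 * Re (c * cinner (E l x) y)"
proof -
  have "cinner (E l y) (c *\<^sub>C x) = cnj (c * cinner (E l x) y)"
    by (metis cinner_commute cinner_scaleC_left symmetric)
  then have "Re (cinner (E l y) (c *\<^sub>C x)) = Re (c * cinner (E l x) y)"
    by (metis complex_cnj(1) complex.sel(1) complex_surj)
  moreover have "cinner (E l (c *\<^sub>C x)) (c *\<^sub>C x) = of_real ((cmod c)\<^sup>2) * cinner (E l x) x"
    unfolding E_scaleC cinner_scaleC_left cinner_scaleC_right complex_norm_square
    by (simp only: ac_simps)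
  ultimately show ?thesis
    by (simp add: \<Phi>_def inner_eq_Re_cinner E.diff cinner.diff_left cinner.diff_right)
      (simp add: E_scaleC cinner_scaleC_left)
qed

text \<open>The final inequality is Cauchy-Schwarz for densities: those of \<open>\<Phi> (c x - y)\<close> are nonnegative for
  every \<open>c\<close>, and \<open>c\<close> may be chosen pointwise.\<close>

lemma complex_density:
  obtains N :: "real measure" and g :: "real \<Rightarrow> complex" and g2 g1 :: "real \<Rightarrow> real"
  where "sets N = sets borel" "integrable N g" "integrable N g2"
    "g \<in> borel_measurable borel" "g1 \<in> borel_measurable borel" "\<And>t. 0 \<le> g1 t"
    "M x = density N (\<lambda>t. ennreal (g1 t))"
    "\<And>a b. a \<le> b \<Longrightarrow> (LINT t:{a<..b}|N. g t) = cinner (E b x) y - cinner (E a x) y"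
    "AE t in N. 2 * \<bar>t\<bar> * cmod (g t) \<le> t\<^sup>2 * g1 t + g2 t"
proof -
  \<comment> \<open>By the parallelogram law, subtracting \<open>\<Phi> (x + y)\<close> or
    \<open>\<Phi> (x + \<i> *\<^sub>C y)\<close> from \<open>\<Psi>\<close> leaves a monotone
    function, as does subtracting \<open>\<Phi> x\<close> or \<open>\<Phi> y\<close>. Hence one
    measure \<open>N\<close> carries densities for all four.\<close>
  define \<Psi> where "\<Psi> l = 2 * (\<Phi> x l + \<Phi> y l)" for l
  define N where "N = interval_measure \<Psi>"
  define C where "C = 2 * ((norm x)\<^sup>2 + (norm y)\<^sup>2)"
  have mono\<Psi>: "mono \<Psi>"
    using mono_\<Phi> by (auto simp: \<Psi>_def mono_def intro!: add_mono)
  have cont\<Psi>: "continuous (at_right a) \<Psi>" for a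
    unfolding \<Psi>_def[abs_def] by (intro continuous_intros continuous_\<Phi>)
  have bd\<Psi>: "\<bar>\<Psi> l\<bar> \<le> C" for l
  proof -
    have "\<bar>\<Phi> x l + \<Phi> y l\<bar> \<le> (norm x)\<^sup>2 + (norm y)\<^sup>2"
      by (intro order.trans[OF abs_triangle_ineq] add_mono \<Phi>_bound)
    then show ?thesis by (simp add: \<Psi>_def C_def abs_mult del: distrib_left_numeral)
  qed
  have dens: "\<exists>D :: real \<Rightarrow> real. D \<in> borel_measurable borel \<and> (\<forall>t. 0 \<le> D t) \<and> M u = density N (\<lambda>t. ennreal (D t))"
    if mono: "mono (\<lambda>l. \<Psi> l - \<Phi> u l)" for u
  proof -
    have bd: "\<bar>\<Phi> u l\<bar> \<le> max C ((norm u)\<^sup>2)" "\<bar>\<Psi> l\<bar> \<le> max C ((norm u)\<^sup>2)" for l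
      using \<Phi>_bound[of u l] bd\<Psi>[of l] by linarith+
    obtain D :: "real \<Rightarrow> real" where "D \<in> borel_measurable borel" "\<And>x. 0 \<le> D x"
      "M u = density (interval_measure \<Psi>) D"
      by (rule interval_measure_density[OF mono_\<Phi> mono\<Psi> mono continuous_\<Phi> cont\<Psi> bd]) (rule that)
    then show ?thesis by (auto simp: N_def)
  qed
  have "mono (\<lambda>l. \<Psi> l - \<Phi> x l)"
    using mono_\<Phi> by (auto simp: \<Psi>_def mono_def intro!: add_mono)
  from dens[OF this] obtain g1 where g1: "g1 \<in> borel_measurable borel" "\<And>t. 0 \<le> g1 t" "M x = density N (\<lambda>t. ennreal (g1 t))"
    by blast
  have "mono (\<lambda>l. \<Psi> l - \<Phi> y l)"
    using mono_\<Phi> by (auto simp: \<Psi>_def mono_def intro!: add_mono)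
  from dens[OF this] obtain g2 where g2: "g2 \<in> borel_measurable borel" "\<And>t. 0 \<le> g2 t" "M y = density N (\<lambda>t. ennreal (g2 t))"
    by blast
  have "(\<lambda>l. \<Psi> l - \<Phi> (x + y) l) = \<Phi> (x - y)"
    unfolding \<Psi>_def \<Phi>_parallelogram[symmetric] by auto
  then have "mono (\<lambda>l. \<Psi> l - \<Phi> (x + y) l)"
    by (simp add: mono_\<Phi>)
  from dens[OF this] obtain p where p: "p \<in> borel_measurable borel" "\<And>t. 0 \<le> p t" "M (x + y) = density N (\<lambda>t. ennreal (p t))"
    by blast
  have "(\<lambda>l. \<Psi> l - \<Phi> (x + \<i> *\<^sub>C y) l) = \<Phi> (x - \<i> *\<^sub>C y)"
    using \<Phi>_parallelogram[of x "\<i> *\<^sub>C y"] by (auto simp: \<Psi>_def \<Phi>_ii algebra_simps)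
  then have "mono (\<lambda>l. \<Psi> l - \<Phi> (x + \<i> *\<^sub>C y) l)"
    by (simp add: mono_\<Phi>)
  from dens[OF this] obtain q where q: "q \<in> borel_measurable borel" "\<And>t. 0 \<le> q t"
    "M (x + \<i> *\<^sub>C y) = density N (\<lambda>t. ennreal (q t))"
    by blast
  have setsN[measurable_cong]: "sets N = sets borel" by (simp add: N_def)
  note [measurable] = g1(1) g2(1) p(1) q(1)
  have int: "integrable N D" and LINT: "a \<le> b \<Longrightarrow> (LINT t:{a<..b}|N. D t) = \<Phi> u b - \<Phi> u a"
    if "M u = density N (\<lambda>t. ennreal (D t))" "D \<in> borel_measurable borel" "\<And>t. 0 \<le> D t"
    for D :: "real \<Rightarrow> real" and u a b
  proof -
    have D: "D \<in> borel_measurable N" using that(2) by simp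
    show "integrable N D"
      by (rule density_integrals(1)[OF finite_measure_M that(1) D that(3)])
    show "(LINT t:{a<..b}|N. D t) = \<Phi> u b - \<Phi> u a" if "a \<le> b"
      using density_integrals(2)[OF finite_measure_M \<open>M u = density N (\<lambda>t. ennreal (D t))\<close> D \<open>\<And>t. 0 \<le> D t\<close>, of "{a<..b}"]
        measure_M_Ioc[OF that] by simp
  qed
  note ints = int[OF g1(3,1,2)] int[OF g2(3,1,2)] int[OF p(3,1,2)] int[OF q(3,1,2)]
  note LINTs = LINT[OF g1(3,1,2)] LINT[OF g2(3,1,2)] LINT[OF p(3,1,2)] LINT[OF q(3,1,2)]
  \<comment> \<open>Polarization: \<open>gr\<close> and \<open>gi\<close> are the densities
    belonging to the real and the imaginary part of \<open>cinner (E l x) y\<close>.\<close>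
  define gr where "gr t = (p t - g1 t - g2 t) / 2" for t
  define gi where "gi t = (q t - g1 t - g2 t) / 2" for t
  define g where "g t = complex_of_real (gr t) + \<i> * complex_of_real (gi t)" for t
  have intr: "integrable N gr" "integrable N gi"
    unfolding gr_def[abs_def] gi_def[abs_def] using ints by auto
  have sint: "set_integrable N {a<..b} f" if "integrable N f"
    for a b and f :: "real \<Rightarrow> 'z::{banach, second_countable_topology}"
    using that by (intro set_integrable_of_integrable) auto
  have Lr: "(LINT t:{a<..b}|N. gr t) = inner (E b x) y - inner (E a x) y" if "a \<le> b" for a b
    unfolding gr_def polarization using LINTs[OF that] ints
    by (simp add: sint set_integral_diff field_simps)
  have Li: "(LINT t:{a<..b}|N. gi t) = inner (E b x) (\<i> *\<^sub>C y) - inner (E a x) (\<i> *\<^sub>C y)"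
    if "a \<le> b" for a b
    unfolding gi_def polarization \<Phi>_ii using LINTs[OF that] ints
    by (simp add: sint set_integral_diff field_simps)
  have intg: "integrable N g"
    unfolding g_def[abs_def] using intr by (intro Bochner_Integration.integrable_add integrable_mult_right integrable_of_real)
  have Lg: "(LINT t:{a<..b}|N. g t) = cinner (E b x) y - cinner (E a x) y" if "a \<le> b" for a b
  proof -
    have "(LINT t:{a<..b}|N. g t) = complex_of_real (LINT t:{a<..b}|N. gr t) + \<i> * complex_of_real (LINT t:{a<..b}|N. gi t)"
      unfolding g_def using intr
      by (simp add: set_integral_add sint set_integral_complex_of_real)
    then show ?thesis
      by (simp add: Lr[OF that] Li[OF that] cinner_eq_inner complex_eq_iff)
  qed
  \<comment> \<open>\<open>F c\<close> turns out to be a density of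
    \<open>M (c *\<^sub>C x - y)\<close> with respect to \<open>N\<close>.\<close>
  define F where "F c t = (cmod c)\<^sup>2 * g1 t + g2 t - 2 * Re (c * g t)" for c t
  have F_alt: "F c t = (cmod c)\<^sup>2 * g1 t + g2 t - 2 * (Re c * gr t - Im c * gi t)" for c t
    by (simp add: F_def g_def)
  have AEF: "AE t in N. 0 \<le> F c t" for c
  proof (rule AE_nonneg_if_set_integrals_nonneg)
    show intF: "integrable N (F c)"
      unfolding F_alt[abs_def] using intr ints by auto
    fix A assume "A \<in> sets N"
    then have A: "A \<in> sets borel" by (simp only: setsN)
    interpret finite_measure "M (c *\<^sub>C x - y)" by (rule finite_measure_M)
    have "(LINT t:A|N. F c t) = measure (M (c *\<^sub>C x - y)) A"
    proof (rule countably_additive_eqI[OF _ _ _ A])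
      fix a b :: real assume ab: "a \<le> b"
      show "(LINT t:{a<..b}|N. F c t) = measure (M (c *\<^sub>C x - y)) {a<..b}"
        unfolding measure_M_Ioc[OF ab] F_alt \<Phi>_scaleC_diff
        using intr ints
        by (simp add: sint set_integral_add set_integral_diff LINTs[OF ab] Lr[OF ab] Li[OF ab]
            cinner_eq_inner algebra_simps)
    qed (auto intro!: finite_measure_UNION set_integral_sums intF)
    then show "0 \<le> (LINT t:A|N. F c t)" by simp
  qed
  have "continuous_on UNIV (\<lambda>c. F c t)" for t
    unfolding F_def by (intro continuous_intros)
  from AE_complex_dense[OF AEF this]
  have "AE t in N. \<forall>c. 0 \<le> F c t" .
  then have am: "AE t in N. 2 * \<bar>t\<bar> * cmod (g t) \<le> t\<^sup>2 * g1 t + g2 t"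
  proof (rule AE_mp, intro AE_I2 impI)
    fix t assume *: "\<forall>c. 0 \<le> F c t"
    show "2 * \<bar>t\<bar> * cmod (g t) \<le> t\<^sup>2 * g1 t + g2 t"
    proof (cases "g t = 0")
      case True
      then show ?thesis using g1(2) g2(2) by simp
    next
      case False
      \<comment> \<open>With this \<open>c\<close> the product \<open>c * g t\<close> is
        \<open>\<bar>t\<bar> * cmod (g t)\<close>, and \<open>0 \<le> F c t\<close> is the
        claim.\<close>
      define c where "c = complex_of_real \<bar>t\<bar> * cnj (sgn (g t))"
      have "c * g t = complex_of_real \<bar>t\<bar> * (g t * cnj (g t)) / cmod (g t)"
        by (simp add: c_def sgn_eq)
      also have "\<dots> = complex_of_real (\<bar>t\<bar> * cmod (g t))"
        using False by (simp add: complex_norm_square[symmetric] power2_eq_square)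
      finally have "Re (c * g t) = \<bar>t\<bar> * cmod (g t)" by simp
      moreover have "cmod c = \<bar>t\<bar>"
        using False by (simp add: c_def norm_mult norm_sgn)
      ultimately show ?thesis
        using *[rule_format, of c] by (simp add: F_def)
    qed
  qed
  have "g \<in> borel_measurable borel"
    unfolding g_def[abs_def] gr_def gi_def by measurable
  from that[OF setsN intg ints(2) this g1(1) g1(2,3) Lg am] show thesis .
qed

text \<open>The measure with density \<open>g\<close> has total variation \<open>K\<close>.
  Integrability of \<open>\<lambda>\<close> follows from the last inequality of
  \<open>complex_density\<close>, since \<open>t\<^sup>2 * g1 t\<close> is integrable for
  \<open>N\<close> exactly when \<open>t\<^sup>2\<close> is for \<open>M x\<close>.\<close>

lemma stieltjes_integral_exists:
  assumes sq: "integrable (M x) (\<lambda>t. t\<^sup>2)"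
  shows "\<exists>I. has_stieltjes_integral (\<lambda>l. cinner (E l x) y) complex_of_real I"
proof (rule complex_density[of x y])
  fix N :: "real measure" and g :: "real \<Rightarrow> complex" and g1 g2 :: "real \<Rightarrow> real"
  assume N[measurable_cong]: "sets N = sets borel" and intg: "integrable N g"
    and intg2: "integrable N g2"
    and [measurable]: "g \<in> borel_measurable borel" "g1 \<in> borel_measurable borel"
    and g1: "\<And>t. 0 \<le> g1 t" and Mx: "M x = density N (\<lambda>t. ennreal (g1 t))"
    and Lg: "\<And>a b. a \<le> b \<Longrightarrow> (LINT t:{a<..b}|N. g t) = cinner (E b x) y - cinner (E a x) y"
    and am: "AE t in N. 2 * \<bar>t\<bar> * cmod (g t) \<le> t\<^sup>2 * g1 t + g2 t"
  define \<mu> where "\<mu> A = (LINT t:A|N. g t)" for A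
  \<comment> \<open>A polar decomposition asks for modulus one everywhere; the default
    \<open>1\<close> sits on a \<open>K\<close>-null set.\<close>
  define h where "h t = (if g t = 0 then 1 else sgn (g t))" for t
  define K where "K = density N (\<lambda>t. ennreal (cmod (g t)))"
  have gh: "cmod (g t) *\<^sub>R h t = g t" for t
    by (auto simp: h_def sgn_div_norm)
  have [measurable]: "h \<in> borel_measurable borel"
    unfolding h_def[abs_def] sgn_div_norm by measurable
  have setsK[measurable_cong]: "sets K = sets borel" by (simp add: K_def N)
  have "polar_decomposition \<mu> K h"
    unfolding polar_decomposition_def
  proof (intro conjI ballI allI)
    have "(\<integral>\<^sup>+t. ennreal (cmod (g t)) \<partial>N) < \<infinity>"
      using intg by (simp add: integrable_iff_bounded)
    then show "finite_measure K"
      by (intro finite_measureI) (simp add: K_def emeasure_density cong: nn_integral_cong)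
    show "norm (h t) = 1" for t
      by (simp add: h_def norm_sgn)
    fix A :: "real set" assume [measurable]: "A \<in> sets borel"
    have "(LINT t:A|K. h t) = (LINT t|N. cmod (g t) *\<^sub>R (indicator A t *\<^sub>R h t))"
      unfolding K_def set_lebesgue_integral_def by (rule integral_density) auto
    also have "\<dots> = \<mu> A"
      unfolding \<mu>_def set_lebesgue_integral_def
      by (intro Bochner_Integration.integral_cong) (auto simp: indicator_def gh)
    finally show "\<mu> A = (LINT t:A|K. h t)" ..
  qed (simp_all add: setsK)
  moreover have "integrable K complex_of_real"
  proof -
    have "integrable N (\<lambda>t. g1 t *\<^sub>R t\<^sup>2)"
      using sq unfolding Mx by (subst (asm) integrable_density) (auto simp: g1)
    then have "integrable N (\<lambda>t. t\<^sup>2 * g1 t + g2 t)"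
      using intg2 by (simp add: mult.commute)
    then have "integrable N (\<lambda>t. cmod (g t) *\<^sub>R complex_of_real t)"
    proof (rule Bochner_Integration.integrable_bound)
      show "AE t in N. norm (cmod (g t) *\<^sub>R complex_of_real t) \<le> norm (t\<^sup>2 * g1 t + g2 t)"
        using am
      proof (rule AE_mp, intro AE_I2 impI)
        fix t assume "2 * \<bar>t\<bar> * cmod (g t) \<le> t\<^sup>2 * g1 t + g2 t"
        moreover have "0 \<le> \<bar>t\<bar> * cmod (g t)" by simp
        ultimately have "\<bar>t\<bar> * cmod (g t) \<le> t\<^sup>2 * g1 t + g2 t"
          by linarith
        moreover have "norm (cmod (g t) *\<^sub>R complex_of_real t) = \<bar>t\<bar> * cmod (g t)"
          by simp
        ultimately show "norm (cmod (g t) *\<^sub>R complex_of_real t) \<le> norm (t\<^sup>2 * g1 t + g2 t)"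
          unfolding real_norm_def by linarith
      qed
    qed measurable
    then show ?thesis
      unfolding K_def by (subst integrable_density) auto
  qed
  moreover have "complex_borel_measure \<mu>"
    unfolding complex_borel_measure_def \<mu>_def by (auto intro!: set_integral_sums intg simp: N)
  moreover have "\<forall>a b. a \<le> b \<longrightarrow> \<mu> {a<..b} = cinner (E b x) y - cinner (E a x) y"
    by (simp add: \<mu>_def Lg)
  ultimately show ?thesis
    unfolding has_stieltjes_integral_def has_complex_integral_def by blast
qed

end

section \<open>The operator \<open>\<integral> \<lambda> dE(\<lambda>)\<close>\<close>

context projection_resolution
begin

lemma linear_S: "linear (\<lambda>x. S x n)"
  unfolding S_def riemann_sum_def
  by (rule linearI)
    (simp_all add: E.add E.scale scaleR_add_right scaleR_diff_right sum.distrib sum_subtractf algebra_simps scaleR_sum_right)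

lemma S_scaleC: "S (c *\<^sub>C x) n = c *\<^sub>C S x n"
proof -
  have "S (c *\<^sub>C x) n = riemann_sum (\<lambda>l. c *\<^sub>C E l x) n"
    by (simp add: S_def E_scaleC)
  also have "\<dots> = c *\<^sub>C S x n"
    unfolding S_def by (rule riemann_sum_linear[symmetric]) (rule bounded_linear.linear[OF bounded_linear_scaleC])
  finally show ?thesis .
qed

lemma riemann_sum_cinner: "riemann_sum (\<lambda>l. cinner (E l x) y) n = cinner (S x n) y"
  unfolding S_def
  by (rule riemann_sum_linear[symmetric]) (rule bounded_linear.linear[OF cinner.bounded_linear_left])

lemma cinner_S: "cinner (S x n) y = cinner x (S y n)"
proof -
  have "cinner (S x n) y = riemann_sum (\<lambda>l. cinner x (E l y)) n"
    by (simp add: riemann_sum_cinner[symmetric] symmetric)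
  also have "\<dots> = cinner x (S y n)"
    unfolding S_def
    by (rule riemann_sum_linear[symmetric]) (rule bounded_linear.linear[OF cinner.bounded_linear_right])
  finally show ?thesis .
qed

section \<open>Cut-off by the spectral projections of \<open>]-m, m]\<close>\<close>

definition P :: "nat \<Rightarrow> 'a \<Rightarrow> 'a" where
  "P m x = E (real m) x - E (- real m) x"

lemma P_tendsto: "(\<lambda>m. P m x) \<longlonglongrightarrow> x"
proof -
  have "(\<lambda>m. P m x) \<longlonglongrightarrow> x - 0"
    unfolding P_def
    by (intro tendsto_diff filterlim_compose[OF E_tendsto_top] filterlim_compose[OF E_tendsto_bot]
        filterlim_real_sequentially filterlim_uminus_at_bot_at_top[THEN filterlim_compose])
  then show ?thesis by simp
qed

lemma cinner_P: "cinner (P m x) y = cinner x (P m y)"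
  by (simp add: P_def cinner.diff_left cinner.diff_right symmetric)

lemma P_P: "P m (P m x) = P m x"
  by (simp add: P_def E.diff E_E)

lemma E_P: "E l (P m x) = P m (E l x)"
  by (simp add: P_def E.diff E_E min.commute)

lemma norm_P_le: "norm (P m x) \<le> norm x"
proof -
  have "(norm (P m x))\<^sup>2 = inner (P m x) x"
    by (metis cinner_P P_P inner_eq_Re_cinner power2_norm_eq_inner)
  also have "\<dots> \<le> norm (P m x) * norm x"
    by (rule norm_cauchy_schwarz)
  finally show ?thesis
    by (cases "norm (P m x) = 0") (auto simp: power2_eq_square)
qed

lemma linear_P: "linear (P m)"
  unfolding P_def by (intro linear_compose_sub bounded_linear.linear bounded_linear_E)

lemma S_P: "S (P m x) n = P m (S x n)"
  unfolding S_def E_P by (rule riemann_sum_linear[symmetric, OF linear_P])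

text \<open>The cells of index \<open>n\<close> lie in \<open>]-(n + 1), n + 1]\<close>, so the
  \<open>n\<close>-th sum does not see what is cut off outside.\<close>

lemma S_P_stable: "S (P (Suc n) x) n = S x n"
  unfolding S_def riemann_sum_def
proof (rule sum.cong[OF refl])
  fix k assume k: "k \<in> cells n"
  note b = cells_grid_bounds[OF k]
  have "grid n k \<le> grid n (k + 1)" by (rule grid_mono) simp
  then show "grid n k *\<^sub>R (E (grid n (k + 1)) (P (Suc n) x) - E (grid n k) (P (Suc n) x)) =
      grid n k *\<^sub>R (E (grid n (k + 1)) x - E (grid n k) x)"
    using b by (simp add: P_def E.diff E_E min_absorb1 min_absorb2 del: of_nat_Suc)
qed

text \<open>\<open>E l (P m x)\<close> is constant in \<open>l\<close> outside
  \<open>]-m, m]\<close>, so the spectral measure of \<open>P m x\<close> gives no mass to the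
  complement.\<close>

lemma square_integrable_P: "integrable (M (P m x)) (\<lambda>t. t\<^sup>2)"
proof -
  let ?u = "P m x"
  interpret finite_measure "M ?u" by (rule finite_measure_M)
  have E_top: "E l ?u = ?u" if "l \<ge> real m" for l
    using that by (simp add: P_def E.diff E_E min_absorb2)
  have E_bot: "E l ?u = 0" if "l \<le> - real m" for l
    using that by (simp add: P_def E.diff E_E min_absorb1)
  have "emeasure (M ?u) {real m<..real m + real n} = 0" for n
    using E_top[of "real m"] E_top[of "real m + real n"]
    by (simp add: emeasure_eq_measure measure_M_Ioc \<Phi>_def)
  moreover have "emeasure (M ?u) {- real m - real n<..- real m} = 0" for n
    using E_bot[of "- real m"] E_bot[of "- real m - real n"]
    by (simp add: emeasure_eq_measure measure_M_Ioc \<Phi>_def)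
  ultimately have "(\<Union>n. {real m<..real m + real n} \<union> {- real m - real n<..- real m}) \<in> null_sets (M ?u)"
    by (intro null_sets_UN null_sets.Un) auto
  then have ae: "AE t in M ?u. \<bar>t\<bar> \<le> m"
  proof (rule AE_I')
    show "{t \<in> space (M ?u). \<not> \<bar>t\<bar> \<le> m} \<subseteq> (\<Union>n. {real m<..real m + real n} \<union> {- real m - real n<..- real m})"
    proof
      fix t assume "t \<in> {t \<in> space (M ?u). \<not> \<bar>t\<bar> \<le> m}"
      moreover obtain n where "\<bar>t\<bar> < real n" using reals_Archimedean2 by blast
      ultimately have "t \<in> {real m<..real m + real n} \<union> {- real m - real n<..- real m}"
        by auto
      then show "t \<in> (\<Union>n. {real m<..real m + real n} \<union> {- real m - real n<..- real m})" by blast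
    qed
  qed
  show ?thesis
  proof (rule integrable_const_bound[where B="(real m)\<^sup>2"])
    show "AE t in M ?u. norm (t\<^sup>2) \<le> (real m)\<^sup>2"
      using ae by (rule AE_mp) (auto intro!: AE_I2 simp: abs_le_square_iff[symmetric])
  qed simp
qed

text \<open>\<open>L x\<close> is the value of \<open>\<integral> \<lambda> dE(\<lambda>)\<close> at \<open>x\<close>; it is junk unless \<open>S x\<close> converges.\<close>

definition L :: "'a \<Rightarrow> 'a" where
  "L x = lim (S x)"

lemma S_tendsto_L: "convergent (S x) \<Longrightarrow> S x \<longlonglongrightarrow> L x"
  by (simp add: L_def convergent_LIMSEQ_iff)

lemma convergent_S_P: "convergent (S (P m x))"
  by (rule S_convergent_if_square_integrable[OF square_integrable_P])

lemma P_L_P: "P m (L (P m x)) = L (P m x)"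
proof (rule LIMSEQ_unique)
  have bl: "bounded_linear (P m)"
    unfolding P_def by (intro bounded_linear_sub bounded_linear_E)
  show "(\<lambda>n. P m (S (P m x) n)) \<longlonglongrightarrow> P m (L (P m x))"
    by (rule bounded_linear.tendsto[OF bl S_tendsto_L[OF convergent_S_P]])
  show "(\<lambda>n. P m (S (P m x) n)) \<longlonglongrightarrow> L (P m x)"
    by (simp add: S_P[symmetric] P_P S_tendsto_L[OF convergent_S_P])
qed

lemma cinner_L:
  assumes "convergent (S x)" "convergent (S y)"
  shows "cinner (L x) y = cinner x (L y)"
proof (rule LIMSEQ_unique)
  show "(\<lambda>n. cinner (S x n) y) \<longlonglongrightarrow> cinner (L x) y"
    by (intro cinner.tendsto S_tendsto_L assms tendsto_const)
  show "(\<lambda>n. cinner (S x n) y) \<longlonglongrightarrow> cinner x (L y)"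
    unfolding cinner_S by (intro cinner.tendsto S_tendsto_L assms tendsto_const)
qed

text \<open>Testing \<open>S x\<close> weakly against \<open>L (P m x)\<close>, which lies in the range of \<open>P m\<close>, bounds
  \<open>\<parallel>L (P m x)\<parallel>\<close>, that is, the integrals of \<open>\<lambda>\<^sup>2\<close> over \<open>]-m, m]\<close>, uniformly in \<open>m\<close>.\<close>

lemma convergent_S_if_weakly_bounded:
  assumes lim: "\<And>m. (\<lambda>n. cinner (S x n) (L (P m x))) \<longlonglongrightarrow> f m"
    and bd: "\<And>m. cmod (f m) \<le> C * norm (L (P m x))" and C: "0 \<le> C"
  shows "convergent (S x)"
proof -
  have LP: "norm (L (P m x)) \<le> C" for m
  proof -
    let ?u = "L (P m x)"
    have "(\<lambda>n. cinner (S (P m x) n) ?u) \<longlonglongrightarrow> cinner ?u ?u"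
      by (intro cinner.tendsto S_tendsto_L convergent_S_P tendsto_const)
    \<comment> \<open>The cut-off is moved onto \<open>?u\<close>, which it fixes.\<close>
    moreover have "cinner (S (P m x) n) ?u = cinner (S x n) ?u" for n
      by (simp add: S_P cinner_P P_L_P)
    ultimately have "cinner ?u ?u = f m"
      using lim[of m] by (simp add: LIMSEQ_unique)
    then have "norm ?u * norm ?u \<le> C * norm ?u"
      using bd[of m] by (metis cinner_self norm_of_real abs_of_nonneg zero_le_power2 power2_eq_square)
    then show ?thesis
      using C by (cases "norm ?u = 0") auto
  qed
  \<comment> \<open>By \<open>S_P_stable\<close>, \<open>x\<close> may be replaced by
    \<open>P (Suc n) x\<close>, whose spectral measure has second moment at most
    \<open>C\<^sup>2\<close> and mass at most \<open>(norm x)\<^sup>2\<close>.\<close>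
  have "norm (S x n) \<le> sqrt (2 * C\<^sup>2 + 2 * (norm x)\<^sup>2)" for n
  proof -
    let ?u = "P (Suc n) x"
    interpret finite_measure "M ?u" by (rule finite_measure_M)
    have sq: "integrable (M ?u) (\<lambda>t. t\<^sup>2)" by (rule square_integrable_P)
    have L_bd: "(LINT t|M ?u. t\<^sup>2) \<le> C\<^sup>2"
    proof -
      have "(\<lambda>k. LINT t|M ?u. staircase k t * staircase k t) \<longlonglongrightarrow> (LINT t|M ?u. t * t)"
      proof (rule integral_dominated_convergence[where w="\<lambda>t. 2 * t\<^sup>2 + 2"])
        show "AE t in M ?u. (\<lambda>k. staircase k t * staircase k t) \<longlonglongrightarrow> t * t"
          by (intro AE_I2 tendsto_intros staircase_tendsto)
        show "AE t in M ?u. norm (staircase k t * staircase k t) \<le> 2 * t\<^sup>2 + 2" for k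
          using square_staircase_le[of k] by (simp add: power2_eq_square)
      qed (use sq in auto)
      moreover have "(\<lambda>k. LINT t|M ?u. staircase k t * staircase k t) \<longlonglongrightarrow> inner (L ?u) (L ?u)"
        unfolding integral_staircase_product_M(2)
        by (intro tendsto_intros S_tendsto_L convergent_S_P)
      ultimately have "(LINT t|M ?u. t * t) = (norm (L ?u))\<^sup>2"
        by (simp add: LIMSEQ_unique power2_norm_eq_inner)
      also have "\<dots> \<le> C\<^sup>2" by (intro power_mono LP) simp
      finally show ?thesis by (simp add: power2_eq_square)
    qed
    have tot: "measure (M ?u) UNIV \<le> (norm x)\<^sup>2"
    proof -
      have "(\<lambda>k. measure (M ?u) {- real k<..real k}) \<longlonglongrightarrow> measure (M ?u) (\<Union>k. {- real k<..real k})"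
        by (rule finite_Lim_measure_incseq) (auto simp: incseq_def)
      moreover have "measure (M ?u) {- real k<..real k} \<le> (norm x)\<^sup>2" for k
      proof -
        have "measure (M ?u) {- real k<..real k} = (norm (P k ?u))\<^sup>2"
          by (simp add: measure_M_Ioc \<Phi>_diff P_def)
        also have "\<dots> \<le> (norm x)\<^sup>2"
          by (intro power_mono order.trans[OF norm_P_le norm_P_le]) simp
        finally show ?thesis .
      qed
      ultimately show ?thesis
        unfolding UN_symmetric_Ioc
        by (intro LIMSEQ_le_const2[of "\<lambda>k. measure (M ?u) {- real k<..real k}"]) auto
    qed
    have "(norm (S x n))\<^sup>2 = (LINT t|M ?u. (staircase n t)\<^sup>2)"
      using integral_staircase_product_M(2)[of ?u n n]
      by (simp add: S_P_stable power2_norm_eq_inner power2_eq_square[of "staircase n _"])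
    also have "\<dots> \<le> (LINT t|M ?u. 2 * t\<^sup>2 + 2)"
      using sq integral_staircase_product_M(1)[of ?u n n]
      by (intro integral_mono square_staircase_le) (auto simp: power2_eq_square)
    also have "\<dots> = 2 * (LINT t|M ?u. t\<^sup>2) + 2 * measure (M ?u) UNIV"
      using sq by simp
    also have "\<dots> \<le> 2 * C\<^sup>2 + 2 * (norm x)\<^sup>2"
      using L_bd tot by simp
    finally show ?thesis by (rule real_le_rsqrt)
  qed
  then show ?thesis
    by (intro S_convergent_if_square_integrable square_integrable_if_S_bounded)
qed

text \<open>Convergence of \<open>S x\<close> gives existence of the integrals, which then equal
  \<open>cinner (L x) y\<close>. Conversely, boundedness of the functional is the weak bound that
  forces convergence.\<close>

lemma spectral_integral_eq:
  "spectral_integral E = (\<lambda>x. if convergent (S x) then Some (L x) else None)"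
proof
  fix x
  let ?F = "\<lambda>y l. cinner (E l x) y"
  let ?C = "(\<forall>y. stieltjes_integrable (?F y) complex_of_real) \<and>
     (\<exists>C. \<forall>y. norm (stieltjes_integral (?F y) complex_of_real) \<le> C * norm y)"
  have int: "(\<lambda>n. cinner (S x n) y) \<longlonglongrightarrow> stieltjes_integral (?F y) complex_of_real"
    if "stieltjes_integrable (?F y) complex_of_real" for y
    using that unfolding stieltjes_integrable_def riemann_sum_cinner[symmetric]
    by (metis has_stieltjes_integral_riemann_sum stieltjes_integral_eq)
  show "spectral_integral E x = (if convergent (S x) then Some (L x) else None)"
  proof (cases "convergent (S x)")
    case True
    then obtain C where "\<And>n. norm (S x n) \<le> C"
      using convergent_imp_Bseq BseqE by metis
    then have "integrable (M x) (\<lambda>t. t\<^sup>2)"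
      by (rule square_integrable_if_S_bounded)
    then have ex: "stieltjes_integrable (?F y) complex_of_real" for y
      unfolding stieltjes_integrable_def by (rule stieltjes_integral_exists)
    have eq: "stieltjes_integral (?F y) complex_of_real = cinner (L x) y" for y
      using int[OF ex] by (rule LIMSEQ_unique) (intro cinner.tendsto S_tendsto_L True tendsto_const)
    have ?C
      using ex cmod_cinner_le[of "L x"] by (auto simp: eq)
    moreover have "(THE z. \<forall>y. cinner z y = stieltjes_integral (?F y) complex_of_real) = L x"
      by (rule the_equality) (auto simp: eq intro: cinner_ext)
    ultimately show ?thesis
      using True by (simp add: spectral_integral_def)
  next
    case False
    have "\<not> ?C"
    proof
      assume C: ?C
      then obtain C where bd: "\<And>y. norm (stieltjes_integral (?F y) complex_of_real) \<le> C * norm y"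
        by blast
      have "convergent (S x)"
      proof (rule convergent_S_if_weakly_bounded[OF int])
        show "stieltjes_integrable (?F (L (P m x))) complex_of_real" for m
          using C by blast
        \<comment> \<open>The constant in the definition carries no sign, hence the maximum.\<close>
        show "cmod (stieltjes_integral (?F (L (P m x))) complex_of_real) \<le> max C 0 * norm (L (P m x))" for m
          by (rule order.trans[OF bd]) (simp add: mult_right_mono)
      qed simp
      then show False using False by simp
    qed
    with False show ?thesis by (simp add: spectral_integral_def)
  qed
qed

lemma dom_spectral_integral: "dom (spectral_integral E) = {x. convergent (S x)}"
  by (auto simp: spectral_integral_eq dom_def split: if_splits)

lemma linear_operator_spectral_integral: "linear_operator (spectral_integral E)"
proof -
  interpret S: linear "\<lambda>x. S x n" for n by (rule linear_S)
  have I: "spectral_integral E x = Some u" if "S x \<longlonglongrightarrow> u" for x u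
    using that by (auto simp: spectral_integral_eq L_def convergent_def limI)
  have D: "S x \<longlonglongrightarrow> u" if "spectral_integral E x = Some u" for x u
    using that S_tendsto_L by (auto simp: spectral_integral_eq split: if_splits)
  show ?thesis
    unfolding linear_operator_def
  proof (intro conjI allI impI)
    show "spectral_integral E 0 = Some 0" by (rule I) (simp add: S.zero[abs_def])
  next
    fix x y u v assume "spectral_integral E x = Some u" "spectral_integral E y = Some v"
    then show "spectral_integral E (x + y) = Some (u + v)"
      by (intro I) (simp add: S.add[abs_def] tendsto_add D)
  next
    fix c x u assume "spectral_integral E x = Some u"
    then show "spectral_integral E (c *\<^sub>C x) = Some (c *\<^sub>C u)"
      by (intro I) (simp add: S_scaleC[abs_def] bounded_linear.tendsto[OF bounded_linear_scaleC] D)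
  qed
qed

lemma densely_defined_spectral_integral: "densely_defined (spectral_integral E)"
proof -
  have "x \<in> closure {x. convergent (S x)}" for x
    unfolding closure_sequential
    by (rule exI[of _ "\<lambda>m. P m x"]) (simp add: convergent_S_P P_tendsto)
  then show ?thesis
    by (auto simp: densely_defined_def dom_spectral_integral)
qed

text \<open>Symmetry of \<open>L\<close> gives one inclusion. If the adjoint is defined at
  \<open>y\<close> with value \<open>z\<close>, pairing with \<open>z\<close> bounds
  \<open>S y\<close> weakly, so \<open>y\<close> lies in the domain.\<close>

lemma self_adjoint_spectral_integral: "self_adjoint_operator (spectral_integral E)"
  unfolding self_adjoint_operator_def
proof (intro conjI linear_operator_spectral_integral densely_defined_spectral_integral)
  let ?A = "spectral_integral E" and ?D = "{x. convergent (S x)}"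
  have the: "the (?A x) = L x" if "x \<in> ?D" for x
    using that by (simp add: spectral_integral_eq)
  \<comment> \<open>Density of the domain, through \<open>P m y\<close>, makes the value of the
    adjoint unique.\<close>
  have eqD: "z = z'" if "\<And>x. x \<in> ?D \<Longrightarrow> cinner x z = cinner x z'" for z z'
  proof (rule cinner_ext)
    fix y
    have "(\<lambda>m. cinner (P m y) z) \<longlonglongrightarrow> cinner y z" "(\<lambda>m. cinner (P m y) z') \<longlonglongrightarrow> cinner y z'"
      by (intro cinner.tendsto P_tendsto tendsto_const)+
    moreover have "cinner (P m y) z = cinner (P m y) z'" for m
      using that convergent_S_P by simp
    ultimately have "cinner y z = cinner y z'"
      by (simp add: LIMSEQ_unique)
    then show "cinner z y = cinner z' y"
      by (metis cinner_commute)
  qed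
  show "adjoint_operator ?A = ?A"
  proof
    fix y
    show "adjoint_operator ?A y = ?A y"
    proof (cases "convergent (S y)")
      case True
      have *: "\<forall>x\<in>?D. cinner (the (?A x)) y = cinner x (L y)"
        using True by (simp add: the cinner_L)
      have "(THE z. \<forall>x\<in>?D. cinner (the (?A x)) y = cinner x z) = L y"
        by (rule the_equality) (use * in \<open>auto intro!: eqD\<close>)
      with * True show ?thesis
        unfolding adjoint_operator_def dom_spectral_integral
        by (auto simp: spectral_integral_eq)
    next
      case False
      have "\<not> (\<exists>z. \<forall>x\<in>?D. cinner (the (?A x)) y = cinner x z)"
      proof
        assume "\<exists>z. \<forall>x\<in>?D. cinner (the (?A x)) y = cinner x z"
        then obtain z where z: "\<And>x. x \<in> ?D \<Longrightarrow> cinner (L x) y = cinner x z"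
          using the by auto
        have "convergent (S y)"
        proof (rule convergent_S_if_weakly_bounded)
          fix m
          let ?u = "L (P m y)"
          have u: "?u \<in> ?D" using convergent_S_P[of m ?u] by (simp add: P_L_P)
          have "(\<lambda>n. cinner y (S ?u n)) \<longlonglongrightarrow> cinner y (L ?u)"
            using u by (intro cinner.tendsto S_tendsto_L tendsto_const) simp
          then show "(\<lambda>n. cinner (S y n) ?u) \<longlonglongrightarrow> cinner z ?u"
            using z[OF u] by (simp add: cinner_S) (metis cinner_commute)
          show "cmod (cinner z ?u) \<le> norm z * norm ?u"
            by (rule cmod_cinner_le)
        qed simp
        then show False using False by simp
      qed
      then show ?thesis
        using False unfolding adjoint_operator_def dom_spectral_integral
        by (simp add: spectral_integral_eq)
    qed
  qed
qed

end

section \<open>Adjoints of bounded operators\<close>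

text \<open>The representing vector is the minimiser of \<open>J\<close>, found by
  completeness.\<close>

lemma riesz_representation_real:
  fixes f :: "'a::{real_inner, banach} \<Rightarrow> real"
  assumes "bounded_linear f"
  shows "\<exists>z. \<forall>x. f x = inner x z"
proof -
  interpret bounded_linear f by fact
  define J where "J x = (norm x)\<^sup>2 - 2 * f x" for x
  obtain K where K: "\<And>x. norm (f x) \<le> norm x * K"
    using bounded by blast
  have "- K\<^sup>2 \<le> J x" for x
  proof -
    have "f x \<le> norm x * K" using K[of x] by simp
    moreover have "0 \<le> (norm x - K)\<^sup>2" by simp
    ultimately show ?thesis by (simp add: J_def power2_eq_square algebra_simps)
  qed
  then have bdd: "bdd_below (range J)" by (rule bdd_belowI2)
  define m where "m = Inf (range J)"
  have m_le: "m \<le> J x" for x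
    unfolding m_def by (rule cInf_lower[OF _ bdd]) simp
  have "\<exists>x. J x < m + 1 / real (Suc n)" for n
  proof -
    have "Inf (range J) < m + 1 / real (Suc n)" by (simp add: m_def)
    then show ?thesis using cInf_lessD[of "range J"] by blast
  qed
  then obtain x where x: "\<And>n. J (x n) < m + 1 / real (Suc n)" by metis
  \<comment> \<open>the parallelogram law turns a minimising sequence of \<open>J\<close> into a Cauchy sequence\<close>
  have par: "(norm (u - v))\<^sup>2 \<le> 2 * (J u - m) + 2 * (J v - m)" for u v
  proof -
    have "(norm (u - v))\<^sup>2 = 2 * J u + 2 * J v - 4 * J ((1 / 2) *\<^sub>R (u + v))"
      unfolding J_def scaleR add power2_norm_eq_inner
      by (simp add: inner_add_left inner_add_right inner_diff_left inner_diff_right inner_commute field_simps)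
    also have "\<dots> \<le> 2 * J u + 2 * J v - 4 * m"
      by (intro diff_left_mono mult_left_mono m_le) simp
    finally show ?thesis by simp
  qed
  have "Cauchy x"
  proof (rule metric_CauchyI)
    fix e :: real assume "e > 0"
    then obtain N where N: "1 / real (Suc N) < e\<^sup>2 / 4"
      using nat_approx_posE[of "e\<^sup>2 / 4"] by auto
    have "dist (x i) (x j) < e" if "i \<ge> N" "j \<ge> N" for i j
    proof -
      have "J (x k) - m < e\<^sup>2 / 4" if "k \<ge> N" for k
      proof -
        have "1 / real (Suc k) \<le> 1 / real (Suc N)"
          using that by (simp add: frac_le)
        then show ?thesis using x[of k] N by linarith
      qed
      from this[OF that(1)] this[OF that(2)]
      have "2 * (J (x i) - m) + 2 * (J (x j) - m) < e\<^sup>2" by simp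
      with par have "(norm (x i - x j))\<^sup>2 < e\<^sup>2" by (rule le_less_trans)
      then show ?thesis
        using \<open>e > 0\<close> by (simp add: dist_norm power2_less_imp_less)
    qed
    then show "\<exists>N. \<forall>i\<ge>N. \<forall>j\<ge>N. dist (x i) (x j) < e" by blast
  qed
  then obtain z where z: "x \<longlonglongrightarrow> z"
    using Cauchy_convergent convergent_def by blast
  have "(\<lambda>n. J (x n)) \<longlonglongrightarrow> J z"
    unfolding J_def by (intro tendsto_intros z tendsto)
  moreover have "(\<lambda>n. m + 1 / real (Suc n)) \<longlonglongrightarrow> m + 0"
    using LIMSEQ_inverse_real_of_nat by (intro tendsto_add) (simp_all add: inverse_eq_divide)
  moreover have "\<exists>N. \<forall>n\<ge>N. J (x n) \<le> m + 1 / real (Suc n)"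
    using x less_imp_le by blast
  ultimately have "J z \<le> m + 0" by (rule LIMSEQ_le)
  then have Jz: "J z \<le> m" by simp
  have "f h = inner h z" for h
  proof (rule ccontr)
    assume ne: "f h \<noteq> inner h z"
    define b where "b = inner h z - f h"
    have hp: "inner h h > 0" using ne by (cases "h = 0") (auto simp: zero)
    \<comment> \<open>The minimiser of \<open>J\<close> on the line through \<open>z\<close> in
      direction \<open>h\<close>; for \<open>b\<close> nonzero it would undercut the
      infimum.\<close>
    define t where "t = - b / inner h h"
    have "J (z + t *\<^sub>R h) = J z + 2 * t * b + t * (t * inner h h)"
      unfolding J_def add scaleR power2_norm_eq_inner b_def
      by (simp add: inner_add_left inner_add_right inner_commute algebra_simps)
    also have "\<dots> = J z - b\<^sup>2 / inner h h"
      using hp by (simp add: t_def power2_eq_square)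
    also have "\<dots> < J z" using hp ne by (simp add: b_def)
    finally show False using Jz m_le[of "z + t *\<^sub>R h"] by linarith
  qed
  then show ?thesis by blast
qed

text \<open>Riesz yields the adjoint for the real inner product; complex linearity of
  \<open>T\<close> carries the identity over to imaginary parts.\<close>

lemma cinner_cadjoint:
  fixes T :: "'a::complex_hilbert_space \<Rightarrow> 'b::complex_hilbert_space"
  assumes T: "bounded_clinear T"
  shows "cinner (T x) y = cinner x (cadjoint T y)"
proof -
  have bl: "bounded_linear T" and sc: "\<And>c x. T (c *\<^sub>C x) = c *\<^sub>C T x"
    using T by (auto simp: bounded_clinear_def)
  have "\<exists>z. \<forall>x. inner (T x) y = inner x z" for y
    by (rule riesz_representation_real)
      (rule bounded_linear_compose[OF bounded_linear_inner_left bl])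
  then obtain S where S: "\<And>x y. inner (T x) y = inner x (S y)" by metis
  have Im: "Im (cinner u v) = - inner (\<i> *\<^sub>C u) v" for u v :: "'z::complex_hilbert_space"
    by (simp add: inner_eq_Re_cinner cinner_scaleC_left)
  have "cinner (T x) y = cinner x (S y)" for x y
    by (rule complex_eqI) (simp_all add: inner_eq_Re_cinner[symmetric] Im sc[symmetric] S)
  then show ?thesis using cadjoint_eqI[of T S] by simp
qed

section \<open>Similarity\<close>

lemma projection_resolution_if_spectral_resolution:
  assumes "spectral_resolution A E"
  shows "projection_resolution E"
proof
  show "resolution_of_identity E"
    using assms by (simp add: spectral_resolution_def)
  then show "cinner (E l x) y = cinner x (E l y)" for l x y
    using assms cinner_cadjoint[of "E l" x y]
    by (simp add: spectral_resolution_def resolution_of_identity_def)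
qed

lemma projection_resolution_if_contractive:
  assumes X: "resolution_of_identity X" and le: "\<And>l. onorm (X l) \<le> 1"
  shows "projection_resolution X"
proof
  fix l x y
  have bc: "bounded_clinear (X l)" using X by (simp add: resolution_of_identity_def)
  show "cinner (X l x) y = cinner x (X l y)"
  proof (rule cinner_idempotent_contraction[OF bc resolution_of_identity_idem[OF X]])
    fix x
    have "norm (X l x) \<le> onorm (X l) * norm x"
      using bc by (intro onorm) (simp add: bounded_clinear_def)
    also have "\<dots> \<le> norm x" using le[of l] by (simp add: mult_left_le_one_le onorm_pos_le bc[unfolded bounded_clinear_def])
    finally show "norm (X l x) \<le> norm x" .
  qed
qed (rule X)

context projection_resolution
begin

lemma cadjoint_E: "cadjoint (E l) = E l"
  by (rule cadjoint_eqI) (rule symmetric)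

lemma star_resolution: "star_resolution_of_identity E"
  using resolution by (simp add: star_resolution_of_identity_def cadjoint_E)

lemma spectral_resolution: "spectral_resolution (spectral_integral E) E"
  using resolution by (auto simp: spectral_resolution_def cadjoint_E E_E)

text \<open>A nonzero vector in the range is fixed, so the contraction attains norm one; with
  \<open>T = id\<close> this is the norm condition of (i).\<close>

lemma onorm_E:
  assumes "E l \<noteq> (\<lambda>_. 0)"
  shows "onorm (E l) = 1"
proof (rule antisym)
  show "onorm (E l) \<le> 1"
    by (rule onorm_bound) (simp_all add: norm_E_le)
  obtain x where x: "E l x \<noteq> 0" using assms by auto
  have "norm (E l (E l x)) \<le> onorm (E l) * norm (E l x)"
    by (rule onorm[OF bounded_linear_E])
  then show "1 \<le> onorm (E l)" using x by (simp add: E_E)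
qed

end

section \<open>Conjugation by the intertwining operator\<close>

lemma bounded_clinear_compose:
  "bounded_clinear f \<Longrightarrow> bounded_clinear g \<Longrightarrow> bounded_clinear (f \<circ> g)"
  by (auto simp: bounded_clinear_def o_def intro: bounded_linear_compose)

lemma resolution_of_identity_conjugate:
  fixes T :: "'k::complex_hilbert_space \<Rightarrow> 'h::complex_hilbert_space"
  assumes E: "resolution_of_identity E"
    and T: "bounded_clinear T" "bounded_clinear (inv T)" "bij T"
    and bdd: "bdd_above (range (\<lambda>l. onorm (T \<circ> E l \<circ> inv T)))"
  shows "resolution_of_identity (\<lambda>l. T \<circ> E l \<circ> inv T)"
proof -
  have [simp]: "inv T (T x) = x" "T (inv T y) = y" for x y
    using T(3) by (simp_all add: bij_is_inj bij_is_surj surj_f_inv_f)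
  interpret T: bounded_linear T using T(1) by (simp add: bounded_clinear_def)
  note E' = E[unfolded resolution_of_identity_def]
  have comm: "E l (E m x) = E l x" "E m (E l x) = E l x" if "l < m" for l m x
    using E' that by (metis comp_apply)+
  have "((\<lambda>l. T (E l (inv T x))) \<longlongrightarrow> T 0) at_bot"
    "((\<lambda>l. T (E l (inv T x))) \<longlongrightarrow> T (inv T x)) at_top"
    "((\<lambda>\<epsilon>. T (E (l + \<epsilon>) (inv T x))) \<longlongrightarrow> T (E l (inv T x))) (at_right 0)" for x l
    by (rule T.tendsto, simp add: E')+
  then show ?thesis
    unfolding resolution_of_identity_def using bdd
    by (auto simp: fun_eq_iff T.zero comm E' intro!: bounded_clinear_compose T)
qed

text \<open>The Riemann sums satisfy \<open>X.S x n = T (E.S (inv T x) n)\<close>, and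
  \<open>T\<close> and \<open>inv T\<close> are continuous; as both operators are limits of Riemann
  sums, domains and values correspond.\<close>

lemma spectral_integral_conjugate:
  fixes T :: "'k::complex_hilbert_space \<Rightarrow> 'h::complex_hilbert_space"
  assumes E: "projection_resolution E" and X: "projection_resolution (\<lambda>l. T \<circ> E l \<circ> inv T)"
    and sim: "similar_via T (spectral_integral E) B"
  shows "B = spectral_integral (\<lambda>l. T \<circ> E l \<circ> inv T)"
proof
  fix x
  have T: "bounded_linear T" "bounded_linear (inv T)" "bij T"
    and dom: "T ` dom (spectral_integral E) = dom B"
    and BT: "\<And>\<xi>. \<xi> \<in> dom (spectral_integral E) \<Longrightarrow> the (B (T \<xi>)) = T (the (spectral_integral E \<xi>))"
    using sim by (auto simp: similar_via_def bounded_clinear_def)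
  have [simp]: "inv T (T u) = u" "T (inv T v) = v" for u v
    using T(3) by (simp_all add: bij_is_inj bij_is_surj surj_f_inv_f)
  interpret E: projection_resolution E by fact
  interpret X: projection_resolution "\<lambda>l. T \<circ> E l \<circ> inv T" by fact
  have SX: "X.S x = (\<lambda>n. T (E.S (inv T x) n))"
    unfolding X.S_def E.S_def
    by (rule ext) (simp add: riemann_sum_linear[OF bounded_linear.linear[OF T(1)]])
  have lim: "X.S x \<longlonglongrightarrow> T u" if "E.S (inv T x) \<longlonglongrightarrow> u" for u
    unfolding SX using that by (rule bounded_linear.tendsto[OF T(1)])
  have lim': "E.S (inv T x) \<longlonglongrightarrow> inv T u" if "X.S x \<longlonglongrightarrow> u" for u
    using bounded_linear.tendsto[OF T(2) that] by (simp add: SX)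
  have conv: "convergent (X.S x) \<longleftrightarrow> convergent (E.S (inv T x))"
    unfolding convergent_def using lim lim' by blast
  have mem: "x \<in> dom B \<longleftrightarrow> convergent (E.S (inv T x))"
  proof -
    have "x \<in> dom B \<longleftrightarrow> inv T x \<in> dom (spectral_integral E)"
      unfolding dom[symmetric] by (metis \<open>\<And>v. T (inv T v) = v\<close> \<open>\<And>u. inv T (T u) = u\<close> image_iff)
    then show ?thesis by (simp add: E.dom_spectral_integral)
  qed
  show "B x = spectral_integral (\<lambda>l. T \<circ> E l \<circ> inv T) x"
  proof (cases "convergent (E.S (inv T x))")
    case True
    then have d: "inv T x \<in> dom (spectral_integral E)" by (simp add: E.dom_spectral_integral)
    have "X.L x = T (E.L (inv T x))"
      unfolding X.L_def by (rule limI) (rule lim[OF E.S_tendsto_L[OF True]])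
    moreover have "the (B x) = T (E.L (inv T x))"
      using BT[OF d] True by (simp add: E.spectral_integral_eq)
    ultimately show ?thesis
      using True mem conv unfolding X.spectral_integral_eq by auto
  next
    case False
    then show ?thesis
      using mem conv unfolding X.spectral_integral_eq by auto
  qed
qed

text \<open>Where \<open>E l\<close> vanishes its conjugate does too, so every \<open>X l\<close> is
  a contraction and thus an orthogonal projection, even if \<open>T\<close> is not unitary. The
  supremum \<open>1\<close> is attained at \<open>l0\<close>.\<close>

lemma star_resolution_if_similar_to_self_adjoint:
  fixes B :: "'h::complex_hilbert_space \<rightharpoonup> 'h"
  assumes "similar_to_self_adjoint_norm_one TYPE('k::complex_hilbert_space) B"
  shows "\<exists>X. star_resolution_of_identity X \<and> res_gamma X = 1 \<and> B = spectral_integral X"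
proof -
  obtain A :: "'k \<rightharpoonup> 'k" and T :: "'k \<Rightarrow> 'h" and E l0 where
    sim: "similar_via T A B" and E: "spectral_resolution A E" and l0: "E l0 \<noteq> (\<lambda>_. 0)"
    and one: "\<And>l. E l \<noteq> (\<lambda>_. 0) \<Longrightarrow> onorm (T \<circ> E l \<circ> inv T) = 1"
    using assms unfolding similar_to_self_adjoint_norm_one_def by blast
  define X where "X = (\<lambda>l. T \<circ> E l \<circ> inv T)"
  have T: "bounded_clinear T" "bounded_clinear (inv T)" "bij T"
    using sim by (auto simp: similar_via_def)
  interpret T: bounded_linear T using T(1) by (simp add: bounded_clinear_def)
  have le: "onorm (X l) \<le> 1" for l
  proof (cases "E l = (\<lambda>_. 0)")
    case True
    then have "X l = (\<lambda>_. 0)" by (simp add: X_def fun_eq_iff T.zero)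
    then show ?thesis by (simp add: onorm_zero)
  next
    case False
    then show ?thesis using one[of l] by (simp add: X_def)
  qed
  have res: "resolution_of_identity X"
    unfolding X_def
    by (rule resolution_of_identity_conjugate[OF _ T])
      (use E le in \<open>auto simp: spectral_resolution_def X_def intro!: bdd_aboveI2[where M=1]\<close>)
  have PX: "projection_resolution X"
    using res le by (rule projection_resolution_if_contractive)
  have "res_gamma X = 1"
    unfolding res_gamma_def
  proof (rule cSup_eq_maximum)
    show "1 \<in> range (\<lambda>l. onorm (X l))"
      using one[OF l0] by (intro range_eqI[of _ _ l0]) (simp add: X_def)
  qed (use le in auto)
  moreover have "B = spectral_integral X"
    using spectral_integral_conjugate[of E T B] projection_resolution_if_spectral_resolution[OF E] PX sim E
    by (simp add: X_def spectral_resolution_def)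
  ultimately show ?thesis
    using projection_resolution.star_resolution[OF PX] by blast
qed

lemma similar_to_self_adjoint_if_star_resolution:
  fixes X :: "real \<Rightarrow> 'h::complex_hilbert_space \<Rightarrow> 'h"
  assumes X: "star_resolution_of_identity X" and gamma: "res_gamma X = 1"
  shows "similar_to_self_adjoint_norm_one TYPE('h) (spectral_integral X)"
proof -
  have res: "resolution_of_identity X"
    using X by (simp add: star_resolution_of_identity_def)
  have "onorm (X l) \<le> 1" for l
    using res unfolding gamma[symmetric] res_gamma_def
    by (intro cSUP_upper) (auto simp: resolution_of_identity_def)
  with res interpret projection_resolution X
    by (rule projection_resolution_if_contractive)
  \<comment> \<open>The zero family would have supremum \<open>0\<close>; this rules out the zero
    space.\<close>
  have "\<exists>l. X l \<noteq> (\<lambda>_. 0)"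
  proof (rule ccontr)
    assume "\<not> ?thesis"
    then have "onorm (X l) = 0" for l by (simp add: onorm_zero)
    then show False using gamma by (simp add: res_gamma_def)
  qed
  moreover have "bounded_clinear (\<lambda>x::'h. x)"
    by (simp add: bounded_clinear_def bounded_linear_ident)
  then have "similar_via id (spectral_integral X) (spectral_integral X)"
    using linear_operator_spectral_integral densely_defined_spectral_integral
    by (simp add: similar_via_def id_def inv_id[unfolded id_def] bij_id[unfolded id_def])
  ultimately show ?thesis
    unfolding similar_to_self_adjoint_norm_one_def
    using self_adjoint_spectral_integral spectral_resolution onorm_E
    by (intro exI[of _ "spectral_integral X"] exI[of _ id] exI[of _ X]) (simp add: o_def id_def inv_id[unfolded id_def])
qed

text \<open>A type cannot be quantified inside a statement, so the equivalence is put for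
  \<open>'h\<close> and the passage from (i) to (ii) is repeated for an arbitrary space
  \<open>'k\<close>.\<close>

theorem theorem3p20:
  fixes B :: "'h::complex_hilbert_space \<rightharpoonup> 'h"
  assumes "closed_operator B"
  shows "(similar_to_self_adjoint_norm_one TYPE('h) B \<longleftrightarrow>
            (\<exists>X. star_resolution_of_identity X \<and> res_gamma X = 1 \<and> B = spectral_integral X)) \<and>
         (similar_to_self_adjoint_norm_one TYPE('k::complex_hilbert_space) B \<longrightarrow>
            (\<exists>X. star_resolution_of_identity X \<and> res_gamma X = 1 \<and> B = spectral_integral X))"
  using star_resolution_if_similar_to_self_adjoint[where 'k='h and B=B]
    star_resolution_if_similar_to_self_adjoint[where 'k='k and B=B]
    similar_to_self_adjoint_if_star_resolution
  by blast

end
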